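(* Let $N\ge1$ and let $T:M(N)\to M(N)$ be a non-zero linear map. Then there exists a non-zero orthogonal projection $P\in M(N)$ such that $$\frac{\|T\|_{2\to2}}{8\sqrt{4\log(48h(T)^2)+2}}<\frac{\|T(P)\|_2}{\|P\|_2}\le\|T\|_{2\to2}.$$
   Context: $M(N)$ is the space of $N\times N$ complex matrices. $\|A\|_p$ is the Schatten-$p$ norm for $1\le p<\infty$ and $\|A\|_\infty$ the operator norm; $\|T\|_{p\to p}=\sup_{X\ne0}\|T(X)\|_p/\|X\|_p$. The height of a non-zero linear map is $h(T)=\sqrt{\|T\|_{1\to1}\|T\|_{\infty\to\infty}}/\|T\|_{2\to2}$. *)

theory Defs
  imports "Jordan_Normal_Form.Schur_Decomposition" "Jordan_Normal_Form.Char_Poly"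
begin

definition singular_values :: "complex mat \<Rightarrow> real multiset" where
  "singular_values A = image_mset (\<lambda>z. sqrt (Re z)) (proots (char_poly (mat_adjoint A * A)))"

definition schatten_norm :: "real \<Rightarrow> complex mat \<Rightarrow> real" where
  "schatten_norm p A = (\<Sum>s\<in>#singular_values A. s powr p) powr (1 / p)"

definition schatten_inf_norm :: "complex mat \<Rightarrow> real" where
  "schatten_inf_norm A = Max (insert 0 (set_mset (singular_values A)))"

definition linear_on_mats :: "nat \<Rightarrow> (complex mat \<Rightarrow> complex mat) \<Rightarrow> bool" where
  "linear_on_mats N T \<longleftrightarrow>
     (\<forall>X \<in> carrier_mat N N. T X \<in> carrier_mat N N) \<and>
     (\<forall>X \<in> carrier_mat N N. \<forall>Y \<in> carrier_mat N N. T (X + Y) = T X + T Y) \<and>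
     (\<forall>X \<in> carrier_mat N N. \<forall>c. T (c \<cdot>\<^sub>m X) = c \<cdot>\<^sub>m T X)"

definition induced_norm :: "nat \<Rightarrow> (complex mat \<Rightarrow> real) \<Rightarrow> (complex mat \<Rightarrow> complex mat) \<Rightarrow> real" where
  "induced_norm N nrm T = Sup {nrm (T X) / nrm X | X. X \<in> carrier_mat N N \<and> X \<noteq> 0\<^sub>m N N}"

definition height :: "nat \<Rightarrow> (complex mat \<Rightarrow> complex mat) \<Rightarrow> real" where
  "height N T = sqrt (induced_norm N (schatten_norm 1) T * induced_norm N schatten_inf_norm T)
                / induced_norm N (schatten_norm 2) T"

definition orth_projection :: "nat \<Rightarrow> complex mat \<Rightarrow> bool" where
  "orth_projection N P \<longleftrightarrow> P \<in> carrier_mat N N \<and> P * P = P \<and> mat_adjoint P = P"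

end

theory Submission
  imports Defs "HOL-Analysis.L2_Norm"
begin

text \<open>
  Write \<open>\<tau>\<close>, \<open>\<alpha>\<close>, \<open>\<beta>\<close> for the induced 2-, 1- and \<open>\<infinity>\<close>-norms of \<open>T\<close>, and suppose that
  \<open>\<parallel>T P\<parallel> \<le> K \<parallel>P\<parallel>\<close> in the 2-norm for all orthogonal projections \<open>P\<close>.
  Splitting a matrix into the positive and negative parts of its Hermitian and skew-Hermitian parts
  yields a positive \<open>X = \<Sum>\<^sub>i x\<^sub>i E\<^sub>i\<close>, with \<open>E\<^sub>i\<close> the rank-one spectral projections and \<open>\<parallel>X\<parallel> = 1\<close>, such
  that \<open>\<eta> = \<parallel>T X\<parallel>\<close> is at least about \<open>\<tau> / 2\<close>.
  If \<open>T X\<close> has singular values \<open>s\<^sub>k\<close> and singular vectors \<open>u\<^sub>k\<close>, \<open>v\<^sub>k\<close>, then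
  \<open>\<eta>\<^sup>2 = \<Sum> s\<^sub>k x\<^sub>i t\<^sub>k\<^sub>i\<close> with \<open>t\<^sub>k\<^sub>i = \<langle>u\<^sub>k, T(E\<^sub>i) v\<^sub>k\<rangle>\<close>, and trace duality bounds the absolute row
  and column sums of \<open>t\<close> by \<open>\<beta>\<close> and \<open>\<alpha>\<close>.
  By a Schur test, pairs \<open>(k, i)\<close> for which the ratio of \<open>x\<^sub>i\<close> to \<open>s\<^sub>k\<close> lies outside a window of
  logarithmic length about \<open>ln (\<alpha> \<beta> / \<eta>\<^sup>2)\<close> contribute at most half of the sum.
  The remaining pairs are grouped into geometric blocks of the \<open>s\<^sub>k\<close> as long as the window. On each
  block only \<open>x\<^sub>i\<close> in an interval \<open>[l, u]\<close> occur, and decomposing such a piece of \<open>X\<close> into its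
  spectral projections costs a factor \<open>K sqrt (1 + ln (u / l) / 2)\<close> by Cauchy-Schwarz. Since every
  \<open>x\<^sub>i\<close> meets at most two blocks, the blocks sum up with a bounded loss, so
  \<open>\<eta> \<le> 3 K sqrt (1 + ln (16 \<alpha> \<beta> / \<eta>\<^sup>2))\<close>.
\<close>

section \<open>Seminorms controlled on indicator functions\<close>

text \<open>With x = m / l, the difference \<open>f\<close> of twice the two sides vanishes at 1 and
  has derivative (x - 1)^2 / (x (x + 1)^2) >= 0. The logarithm on the right telescopes over
  successive levels, which the left side does not.\<close>

lemma diff_over_sum_le_half_ln:
  fixes l m :: real
  assumes "0 < l" "l \<le> m"
  shows "(m - l) / (m + l) \<le> ln (m / l) / 2"
proof -
  define f where "f x = ln x - 2 * (x - 1) / (x + 1)" for x :: real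
  have "f 1 \<le> f (m / l)"
  proof (rule DERIV_nonneg_imp_nondecreasing[where f = f])
    show "1 \<le> m / l" using assms by simp
    fix x :: real assume x: "1 \<le> x" "x \<le> m / l"
    have "(f has_real_derivative (1 / x - 4 / (x + 1)\<^sup>2)) (at x)"
      unfolding f_def using x
      by (auto intro!: derivative_eq_intros simp: field_simps power2_eq_square)
    moreover have "1 / x - 4 / (x + 1)\<^sup>2 = (x - 1)\<^sup>2 / (x * (x + 1)\<^sup>2)"
      using x by (simp add: divide_simps) (simp add: power2_eq_square algebra_simps)
    moreover have "(x - 1)\<^sup>2 / (x * (x + 1)\<^sup>2) \<ge> 0" using x by simp
    ultimately show "\<exists>y. (f has_real_derivative y) (at x) \<and> 0 \<le> y" by metis
  qed
  moreover have "2 * (m / l - 1) / (m / l + 1) = 2 * ((m - l) / (m + l))"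
    using assms by (simp add: divide_simps)
  ultimately show ?thesis unfolding f_def by (simp add: mult.commute)
qed

text \<open>Abstracts the map a -> ||T(sum_i a_i E_i)|| for the rank-one spectral projections E_i of
  one fixed basis. The projection sum_(i in I) E_i has 2-norm sqrt (card I), so
  \<open>p_indicator\<close> is the assumed bound on projections.\<close>

locale restricted_seminorm =
  fixes N :: nat and p :: "(nat \<Rightarrow> real) \<Rightarrow> real" and K :: real
  assumes p_add: "p (\<lambda>i. a i + b i) \<le> p a + p b"
    and p_scale: "c \<ge> 0 \<Longrightarrow> p (\<lambda>i. c * a i) \<le> c * p a"
    and p_indicator: "I \<subseteq> {..<N} \<Longrightarrow> p (\<lambda>i. if i \<in> I then 1 else 0) \<le> K * sqrt (card I)"
    and K_nonneg: "K \<ge> 0"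
begin


text \<open>Layer-cake decomposition: subtract a multiple of the indicator of I up to the minimum of
  x on I, then continue on the indices above the minimum. The free parameter s splits the cost of
  each layer by AM-GM into a part that telescopes to the sum of squares and a part that telescopes
  to a logarithm; s is optimised only in \<open>level_bound\<close>.\<close>

lemma shifted_level_bound:
  assumes "I \<subseteq> {..<N}" "0 < l" "l \<le> u" "\<And>i. i \<in> I \<Longrightarrow> l \<le> x i \<and> x i \<le> u" "s > 0"
  shows "2 * p (\<lambda>i. if i \<in> I then x i - l else 0)
    \<le> K * (s * (\<Sum>i\<in>I. (x i)\<^sup>2 - l\<^sup>2) + ln (u / l) / 2 / s)"
  using assms(1-4)
proof (induction "card I" arbitrary: I l rule: less_induct)
  case less
  have fin: "finite I" using less.prems(1) finite_subset by blast
  show ?case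
  proof (cases "I = {}")
    case True
    have "p (\<lambda>i. 0) \<le> 0" using p_indicator[of "{}"] by simp
    moreover have "0 \<le> K * (ln (u / l) / 2 / s)"
      using K_nonneg less.prems assms(5) by (simp add: )
    ultimately show ?thesis using True by simp
  next
    case False
    \<comment> \<open>The recursion restarts from level m on the strictly smaller set J, hence the
      induction over card I with l arbitrary.\<close>
    define m where "m = Min (x ` I)"
    define J where "J = {i \<in> I. x i \<noteq> m}"
    have "m \<in> x ` I" unfolding m_def using fin False by simp
    then obtain i0 where i0: "i0 \<in> I" "x i0 = m" by auto
    have lm: "l \<le> m" "m \<le> u" "0 < m" using less.prems(2,4) i0 by fastforce+
    have mle: "m \<le> x i" if "i \<in> I" for i unfolding m_def using fin that by simp
    have "J \<subset> I" using i0 unfolding J_def by auto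
    then have JI: "card J < card I" "J \<subseteq> I" using fin by (auto intro: psubset_card_mono)
    have IH: "2 * p (\<lambda>i. if i \<in> J then x i - m else 0)
      \<le> K * (s * (\<Sum>i\<in>J. (x i)\<^sup>2 - m\<^sup>2) + ln (u / m) / 2 / s)"
      by (rule less.hyps[OF JI(1)]) (use less.prems JI lm mle in \<open>auto\<close>)
    have split: "(\<lambda>i. if i \<in> I then x i - l else 0) =
      (\<lambda>i. (m - l) * (if i \<in> I then 1 else 0) + (if i \<in> J then x i - m else 0))"
      by (auto simp: J_def)
    have "p (\<lambda>i. if i \<in> I then x i - l else 0) \<le>
       (m - l) * (K * sqrt (card I)) + p (\<lambda>i. if i \<in> J then x i - m else 0)"
      unfolding split
      using p_add[of "\<lambda>i. (m - l) * (if i \<in> I then 1 else 0)" "\<lambda>i. if i \<in> J then x i - m else 0"]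
        p_scale[of "m - l" "\<lambda>i. if i \<in> I then 1 else 0"] 
        mult_left_mono[OF p_indicator[OF less.prems(1)], of "m - l"] lm by linarith
    \<comment> \<open>AM-GM, obtained from the square of s (m + l) q - 1. Here m^2 - l^2 = (m - l)(m
      + l) is the increment of the squares between the two levels.\<close>
    moreover have "2 * ((m - l) * sqrt (card I)) \<le> s * (card I * (m\<^sup>2 - l\<^sup>2)) + (m - l) / (m + l) / s"
    proof -
      have pos: "m + l > 0" using lm less.prems by linarith
      define q where "q = sqrt (real (card I))"
      have q: "real (card I) = q\<^sup>2" unfolding q_def by simp
      have "0 \<le> (m - l) / ((m + l) * s) * (s * (m + l) * q - 1)\<^sup>2"
        using lm pos assms(5) by simp
      also have "\<dots> = s * (q\<^sup>2 * (m\<^sup>2 - l\<^sup>2)) + (m - l) / (m + l) / s - 2 * ((m - l) * q)"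
        using pos assms(5) by (simp add: divide_simps) (simp add: power2_eq_square algebra_simps)
      finally show ?thesis unfolding q unfolding q_def by simp
    qed
    moreover have "(m - l) / (m + l) / s \<le> ln (m / l) / 2 / s"
      by (rule divide_right_mono[OF diff_over_sum_le_half_ln[OF less.prems(2) lm(1)]]) (use assms(5) in simp)
    ultimately have "2 * p (\<lambda>i. if i \<in> I then x i - l else 0) \<le>
        K * (s * (card I * (m\<^sup>2 - l\<^sup>2)) + ln (m / l) / 2 / s) +
        K * (s * (\<Sum>i\<in>J. (x i)\<^sup>2 - m\<^sup>2) + ln (u / m) / 2 / s)"
      using IH mult_left_mono[of "2 * ((m - l) * sqrt (card I))"
          "s * (card I * (m\<^sup>2 - l\<^sup>2)) + ln (m / l) / 2 / s" K] K_nonneg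
      by (simp add: algebra_simps)
    \<comment> \<open>Telescoping: the logarithms of m / l and u / m add up, and the indices of I
      outside J contribute 0 to the sum of squares based at m.\<close>
    also have "ln (u / m) = ln (u / l) - ln (m / l)"
      using lm less.prems by (simp add: ln_div)
    also have "(\<Sum>i\<in>J. (x i)\<^sup>2 - m\<^sup>2) = (\<Sum>i\<in>I. (x i)\<^sup>2 - m\<^sup>2)"
      by (rule sum.mono_neutral_left) (use fin JI in \<open>auto simp: J_def\<close>)
    also have "(\<Sum>i\<in>I. (x i)\<^sup>2 - m\<^sup>2) = (\<Sum>i\<in>I. (x i)\<^sup>2 - l\<^sup>2) - card I * (m\<^sup>2 - l\<^sup>2)"
      by (simp add: sum_subtractf algebra_simps)
    finally show ?thesis using assms(5) by (simp add: algebra_simps diff_divide_distrib)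
  qed
qed

text \<open>The bottom layer, l times the indicator of I, accounts for the summand 1 under the root;
  everything above l is covered by \<open>shifted_level_bound\<close>. Bounding each constant layer
  of x separately and using Cauchy-Schwarz over the layers would lead to the same shape.\<close>

lemma level_bound:
  assumes "I \<subseteq> {..<N}" "0 < l" "l \<le> u" "\<And>i. i \<in> I \<Longrightarrow> l \<le> x i \<and> x i \<le> u"
  shows "p (\<lambda>i. if i \<in> I then x i else 0) \<le> K * sqrt (1 + ln (u / l) / 2) * sqrt (\<Sum>i\<in>I. (x i)\<^sup>2)"
proof (cases "I = {}")
  case True
  then show ?thesis using p_indicator[of "{}"] by simp
next
  case False
  have fin: "finite I" using assms(1) finite_subset by blast
  define X where "X = (\<Sum>i\<in>I. (x i)\<^sup>2)"
  define S where "S = 1 + ln (u / l) / 2"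
  have X: "X > 0" unfolding X_def
    by (rule sum_pos[OF fin False]) (use assms in force)
  have "ln (u / l) \<ge> 0" using assms by simp
  then have S: "S \<ge> 1" unfolding S_def by simp
  \<comment> \<open>This s balances the two terms of s X + S / s, each of which becomes sqrt S *
    sqrt X.\<close>
  define s where "s = sqrt S / sqrt X"
  have s: "s > 0" unfolding s_def using S X by simp
  have split: "(\<lambda>i. if i \<in> I then x i else 0) =
      (\<lambda>i. l * (if i \<in> I then 1 else 0) + (if i \<in> I then x i - l else 0))"
    by auto
  have "p (\<lambda>i. if i \<in> I then x i else 0) \<le>
       l * (K * sqrt (card I)) + p (\<lambda>i. if i \<in> I then x i - l else 0)"
    unfolding split
    using p_add[of "\<lambda>i. l * (if i \<in> I then 1 else 0)" "\<lambda>i. if i \<in> I then x i - l else 0"]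
        p_scale[of l "\<lambda>i. if i \<in> I then 1 else 0"] 
        mult_left_mono[OF p_indicator[OF assms(1)], of l] assms by linarith
  moreover have "2 * (l * sqrt (card I)) \<le> s * (card I * l\<^sup>2) + 1 / s"
  proof -
    define q where "q = sqrt (real (card I))"
    have q: "real (card I) = q\<^sup>2" unfolding q_def by simp
    have "0 \<le> (s * l * q - 1)\<^sup>2 / s" using s by simp
    also have "\<dots> = s * (q\<^sup>2 * l\<^sup>2) + 1 / s - 2 * (l * q)"
      using s by (simp add: divide_simps) (simp add: power2_eq_square algebra_simps)
    finally show ?thesis unfolding q unfolding q_def by simp
  qed
  ultimately have "2 * p (\<lambda>i. if i \<in> I then x i else 0) \<le>
      K * (s * (card I * l\<^sup>2) + 1 / s) + K * (s * (\<Sum>i\<in>I. (x i)\<^sup>2 - l\<^sup>2) + ln (u / l) / 2 / s)"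
    using shifted_level_bound[of I l u x s, OF assms s] mult_left_mono[of "2 * (l * sqrt (card I))"
          "s * (card I * l\<^sup>2) + 1 / s" K] K_nonneg
    by (simp add: algebra_simps)
  also have "\<dots> = K * (s * X + S / s)"
    unfolding X_def S_def by (simp add: sum_subtractf algebra_simps add_divide_distrib)
  also have "s * X = sqrt S * sqrt X"
    unfolding s_def using X by (simp add: field_simps)
  also have "S / s = sqrt S * sqrt X"
    unfolding s_def using X S by (simp add: field_simps)
  finally show ?thesis unfolding X_def S_def by (simp add: mult_ac)
qed

end

section \<open>Schur tests for matrices with bounded row and column sums\<close>

lemma weighted_schur_test:
  fixes t :: "nat \<Rightarrow> nat \<Rightarrow> real"
  assumes "\<And>k i. t k i \<ge> 0"
    and row: "\<And>k. k < N \<Longrightarrow> (\<Sum>i<N. t k i) \<le> \<beta>"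
    and col: "\<And>i. i < N \<Longrightarrow> (\<Sum>k<N. t k i) \<le> \<alpha>"
    and s: "(\<Sum>k<N. (s k)\<^sup>2) = 1" and x: "(\<Sum>i<N. (x i)\<^sup>2) = 1"
    and "a \<ge> 0" "b \<ge> 0"
  shows "(\<Sum>k<N. \<Sum>i<N. (a * (s k)\<^sup>2 + b * (x i)\<^sup>2) * t k i) \<le> a * \<beta> + b * \<alpha>"
proof -
  have "(\<Sum>k<N. \<Sum>i<N. (a * (s k)\<^sup>2 + b * (x i)\<^sup>2) * t k i) =
     (\<Sum>k<N. a * (s k)\<^sup>2 * (\<Sum>i<N. t k i)) + (\<Sum>k<N. \<Sum>i<N. b * (x i)\<^sup>2 * t k i)"
    by (simp add: distrib_right sum.distrib sum_distrib_left)
  \<comment> \<open>After exchanging the sums, the weight of x_i meets a column sum, just as the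
    weight of s_k meets a row sum.\<close>
  also have "(\<Sum>k<N. \<Sum>i<N. b * (x i)\<^sup>2 * t k i) = (\<Sum>i<N. b * (x i)\<^sup>2 * (\<Sum>k<N. t k i))"
    by (subst sum.swap) (simp add: sum_distrib_left)
  also have "(\<Sum>k<N. a * (s k)\<^sup>2 * (\<Sum>i<N. t k i)) \<le> (\<Sum>k<N. a * (s k)\<^sup>2 * \<beta>)"
    by (rule sum_mono, rule mult_left_mono) (use row assms in auto)
  also have "\<dots> = a * \<beta> * (\<Sum>k<N. (s k)\<^sup>2)" by (simp add: sum_distrib_left mult_ac)
  also have "(\<Sum>i<N. b * (x i)\<^sup>2 * (\<Sum>k<N. t k i)) \<le> (\<Sum>i<N. b * (x i)\<^sup>2 * \<alpha>)"
    by (rule sum_mono, rule mult_left_mono) (use col assms in auto)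
  also have "\<dots> = b * \<alpha> * (\<Sum>i<N. (x i)\<^sup>2)" by (simp add: sum_distrib_left mult_ac)
  finally show ?thesis unfolding s x by simp
qed

lemma schur_test:
  fixes t :: "nat \<Rightarrow> nat \<Rightarrow> complex"
  assumes "\<And>k. k < N \<Longrightarrow> (\<Sum>i<N. cmod (t k i)) \<le> \<beta>" "\<And>i. i < N \<Longrightarrow> (\<Sum>k<N. cmod (t k i)) \<le> \<alpha>"
    and "(\<Sum>k<N. (s k)\<^sup>2) = 1" "(\<Sum>i<N. (x i)\<^sup>2) = 1" "\<alpha> > 0" "\<beta> > 0"
  shows "cmod (\<Sum>k<N. \<Sum>i<N. of_real (s k * x i) * t k i) \<le> sqrt (\<alpha> * \<beta>)"
proof -
  \<comment> \<open>The weight in |s x| <= \<theta> s^2 / 2 + x^2 / (2 \<theta>) is chosen to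
    balance row and column bounds.\<close>
  define \<theta> where "\<theta> = sqrt \<alpha> / sqrt \<beta>"
  have \<theta>: "\<theta> > 0" unfolding \<theta>_def using assms by simp
  have "cmod (\<Sum>k<N. \<Sum>i<N. of_real (s k * x i) * t k i)
      \<le> (\<Sum>k<N. \<Sum>i<N. cmod (of_real (s k * x i) * t k i))"
    by (rule order_trans[OF norm_sum sum_mono[OF norm_sum]])
  also have "\<dots> \<le> (\<Sum>k<N. \<Sum>i<N. (\<theta> / 2 * (s k)\<^sup>2 + 1 / (2 * \<theta>) * (x i)\<^sup>2) * cmod (t k i))"
  proof (intro sum_mono)
    fix k i
    have "0 \<le> (\<theta> * \<bar>s k\<bar> - \<bar>x i\<bar>)\<^sup>2 / (2 * \<theta>)" using \<theta> by simp
    also have "\<dots> = \<theta> / 2 * (s k)\<^sup>2 + 1 / (2 * \<theta>) * (x i)\<^sup>2 - \<bar>s k\<bar> * \<bar>x i\<bar>"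
      using \<theta> by (simp add: divide_simps) (simp add: power2_eq_square algebra_simps)
    finally show "cmod (of_real (s k * x i) * t k i) \<le>
        (\<theta> / 2 * (s k)\<^sup>2 + 1 / (2 * \<theta>) * (x i)\<^sup>2) * cmod (t k i)"
      by (simp add: norm_mult abs_mult mult_right_mono)
  qed
  also have "\<dots> \<le> \<theta> / 2 * \<beta> + 1 / (2 * \<theta>) * \<alpha>"
    by (rule weighted_schur_test) (use assms \<theta> in auto)
  also have "\<theta> / 2 * \<beta> + 1 / (2 * \<theta>) * \<alpha> = sqrt (\<alpha> * \<beta>)"
  proof -
    define a b where "a = sqrt \<alpha>" and "b = sqrt \<beta>"
    have ab: "a > 0" "b > 0" "\<alpha> = a\<^sup>2" "\<beta> = b\<^sup>2" using assms by (auto simp: a_def b_def)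
    then show ?thesis unfolding \<theta>_def
      by (simp add: real_sqrt_mult divide_simps) (simp add: power2_eq_square algebra_simps)
  qed
  finally show ?thesis .
qed

section \<open>Decomposition of the bilinear form into geometric blocks\<close>

lemma card_ints_half_open_interval_le_2:
  fixes y :: real
  assumes "\<And>m. m \<in> M \<Longrightarrow> of_int m \<le> y \<and> y < of_int m + 2"
  shows "card (M :: int set) \<le> 2"
proof -
  have "M \<subseteq> {\<lfloor>y\<rfloor> - 1, \<lfloor>y\<rfloor>}"
  proof
    fix m assume "m \<in> M"
    then have "of_int m \<le> y" "y < of_int m + 2" using assms by auto
    then have "m \<le> \<lfloor>y\<rfloor>" "\<lfloor>y\<rfloor> < m + 2" by linarith+
    then show "m \<in> {\<lfloor>y\<rfloor> - 1, \<lfloor>y\<rfloor>}" by auto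
  qed
  then have "card M \<le> card {\<lfloor>y\<rfloor> - 1, \<lfloor>y\<rfloor>}" by (rule card_mono[rotated]) simp
  also have "\<dots> \<le> 2" by (simp add: card_insert_le_m1)
  finally show ?thesis .
qed

text \<open>The entries far from the line "x_i comparable to s_k" are removed by the weighted Schur
  test, the others are handled block by block in s with \<open>level_bound\<close>. The hypothesis
  \<open>dual\<close> is what links the form to p: it is Cauchy-Schwarz over any set J of rows, and
  is applied to one block at a time.\<close>

lemma (in restricted_seminorm) bilinear_form_bound:
  fixes t :: "nat \<Rightarrow> nat \<Rightarrow> complex"
  assumes row: "\<And>k. k < N \<Longrightarrow> (\<Sum>i<N. cmod (t k i)) \<le> \<beta>"
    and col: "\<And>i. i < N \<Longrightarrow> (\<Sum>k<N. cmod (t k i)) \<le> \<alpha>"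
    and s1: "(\<Sum>k<N. (s k)\<^sup>2) = 1" and x1: "(\<Sum>i<N. (x i)\<^sup>2) = 1" and pos: "\<alpha> > 0" "\<beta> > 0"
    and s0: "\<And>k. s k \<ge> 0" and x0: "\<And>i. x i \<ge> 0"
    and dual: "\<And>J a. J \<subseteq> {..<N} \<Longrightarrow>
      cmod (\<Sum>k\<in>J. \<Sum>i<N. of_real (s k * a i) * t k i) \<le> sqrt (\<Sum>k\<in>J. (s k)\<^sup>2) * p a"
    and \<eta>_def: "\<eta> = cmod (\<Sum>k<N. \<Sum>i<N. of_real (s k * x i) * t k i)" and \<eta>: "\<eta> > 0"
  shows "\<eta>\<^sup>2 \<le> \<alpha> * \<beta>" and "\<eta> \<le> 3 * K * sqrt (1 + ln (16 * \<alpha> * \<beta> / \<eta>\<^sup>2))"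
proof -
  \<comment> \<open>Ratio of the two ends \<eta> / (4 \<beta>) and 4 \<alpha> / \<eta> of the window
    allowed for x_i / s_k. The plain Schur test shows Q >= 16, so that Q can serve as the base of
    the blocks.\<close>
  define Q where "Q = 16 * \<alpha> * \<beta> / \<eta>\<^sup>2"
  have "\<eta> \<le> sqrt (\<alpha> * \<beta>)"
    unfolding \<eta>_def by (rule schur_test) (use assms in auto)
  then show schur: "\<eta>\<^sup>2 \<le> \<alpha> * \<beta>" using \<eta> pos by (metis less_eq_real_def real_sqrt_le_iff real_sqrt_unique)
  have Q: "Q \<ge> 16" unfolding Q_def using \<eta> schur by (simp add: field_simps)
  define e where "e k = \<lfloor>log Q (s k)\<rfloor>" for k
  have e: "Q powr (e k) \<le> s k" "s k < Q powr (e k + 1)" if "s k > 0" for k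
  proof -
    have "of_int (e k) \<le> log Q (s k)" "log Q (s k) < of_int (e k) + 1" unfolding e_def by linarith+
    then show "Q powr (e k) \<le> s k" "s k < Q powr (e k + 1)"
      using Q that by (simp_all add: le_log_iff log_less_iff)
  qed
  \<comment> \<open>If Q^m <= s_k < Q^(m+1), then every x_i in the window of s_k lies between L m
    and U m. Window and block each contribute a factor Q, so U m / L m = Q^2.\<close>
  define L where "L m = \<eta> / (4 * \<beta>) * Q powr (of_int m)" for m :: int
  define U where "U m = 4 * \<alpha> / \<eta> * Q powr (of_int m + 1)" for m :: int
  have L0: "L m > 0" for m unfolding L_def using \<eta> pos Q by simp
  have UL: "U m = L m * Q powr 2" for m
  proof -
    have "Q powr (of_int m + 1) = Q powr (of_int m) * Q" using Q by (simp add: powr_add)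
    moreover have "Q powr 2 = Q * Q" using Q by (simp add: powr_numeral power2_eq_square)
    moreover have "4 * \<alpha> / \<eta> = \<eta> / (4 * \<beta>) * Q"
      unfolding Q_def using \<eta> pos by (simp add: divide_simps power2_eq_square)
    ultimately show ?thesis unfolding U_def L_def by simp
  qed
  have LU: "L m \<le> U m" for m
    unfolding UL using L0[of m] Q ge_one_powr_ge_zero[of Q 2] by simp
  define I where "I m = {i \<in> {..<N}. L m \<le> x i \<and> x i < U m}" for m
  define J where "J = {k \<in> {..<N}. s k > 0}"
  define M where "M = e ` J"
  have fin: "finite J" "finite M" "\<And>m. finite (I m)" unfolding J_def M_def I_def by auto
  define S where "S = sqrt (1 + ln Q)"
  have S0: "S \<ge> 0" unfolding S_def using Q by simp
  define f where "f k i = (of_real (s k * x i) * t k i :: complex)" for k i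
  \<comment> \<open>The part of the form that is kept. Rows with s_k = 0, where the logarithm in
    \<open>e\<close> has no meaning, are set to 0 here and vanish in f as well.\<close>
  define g where "g k i = (if s k > 0 \<and> i \<in> I (e k) then f k i else 0)" for k i

  \<comment> \<open>Outside the window one factor dominates, so s_k x_i is at most a multiple of one
    square alone. The constants 4 in L and U make each of the two cases cost \<eta> / 4 in the Schur
    test.\<close>
  have "cmod (\<Sum>k<N. \<Sum>i<N. f k i - g k i) \<le> (\<Sum>k<N. \<Sum>i<N. cmod (f k i - g k i))"
    by (rule order_trans[OF norm_sum sum_mono[OF norm_sum]])
  also have "\<dots> \<le> (\<Sum>k<N. \<Sum>i<N. (\<eta> / (4 * \<beta>) * (s k)\<^sup>2 + \<eta> / (4 * \<alpha>) * (x i)\<^sup>2) * cmod (t k i))"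
  proof (intro sum_mono)
    fix k i assume "k \<in> {..<N}" and i: "i \<in> {..<N}"
    show "cmod (f k i - g k i) \<le> (\<eta> / (4 * \<beta>) * (s k)\<^sup>2 + \<eta> / (4 * \<alpha>) * (x i)\<^sup>2) * cmod (t k i)"
    proof (cases "s k > 0 \<and> i \<notin> I (e k)")
      case False
      then have "f k i - g k i = 0" using s0[of k] unfolding f_def g_def by (cases "s k = 0") auto
      then show ?thesis using \<eta> pos by simp
    next
      case True
      have "s k * x i \<le> \<eta> / (4 * \<beta>) * (s k)\<^sup>2 + \<eta> / (4 * \<alpha>) * (x i)\<^sup>2"
      proof (cases "x i < L (e k)")
        case lo: True
        have "L (e k) \<le> \<eta> / (4 * \<beta>) * s k"
          unfolding L_def by (rule mult_left_mono) (use e[of k] True \<eta> pos in auto)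
        then have "s k * x i \<le> s k * (\<eta> / (4 * \<beta>) * s k)"
          using lo s0[of k] by (intro mult_left_mono) auto
        also have "\<dots> \<le> \<eta> / (4 * \<beta>) * (s k)\<^sup>2 + \<eta> / (4 * \<alpha>) * (x i)\<^sup>2"
          using \<eta> pos by (simp add: power2_eq_square mult_ac)
        finally show ?thesis .
      next
        case False
        then have "U (e k) \<le> x i" using True i unfolding I_def by auto
        then have "Q powr (e k + 1) \<le> \<eta> / (4 * \<alpha>) * x i"
          unfolding U_def using \<eta> pos by (simp add: field_simps)
        then have "s k \<le> \<eta> / (4 * \<alpha>) * x i" using e(2)[of k] True by linarith
        then have "s k * x i \<le> \<eta> / (4 * \<alpha>) * x i * x i"
          using x0[of i] by (intro mult_right_mono) auto
        also have "\<dots> \<le> \<eta> / (4 * \<beta>) * (s k)\<^sup>2 + \<eta> / (4 * \<alpha>) * (x i)\<^sup>2"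
          using \<eta> pos by (simp add: power2_eq_square mult_ac)
        finally show ?thesis .
      qed
      then show ?thesis using True s0 x0 unfolding f_def g_def
        by (auto simp: norm_mult abs_mult intro: mult_right_mono)
    qed
  qed
  also have "\<dots> \<le> \<eta> / (4 * \<beta>) * \<beta> + \<eta> / (4 * \<alpha>) * \<alpha>"
    by (rule weighted_schur_test) (use assms in auto)
  also have "\<dots> = \<eta> / 2" using pos by simp
  finally have outside: "cmod (\<Sum>k<N. \<Sum>i<N. f k i - g k i) \<le> \<eta> / 2" .

  define B where "B m = {k \<in> J. e k = m}" for m
  define c where "c m = sqrt (\<Sum>k\<in>B m. (s k)\<^sup>2)" for m
  define z where "z m = sqrt (\<Sum>i\<in>I m. (x i)\<^sup>2)" for m
  have csum: "(\<Sum>m\<in>M. (c m)\<^sup>2) \<le> 1"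
  proof -
    have "(\<Sum>m\<in>M. (c m)\<^sup>2) = (\<Sum>m\<in>M. \<Sum>k\<in>B m. (s k)\<^sup>2)" unfolding c_def by (simp add: sum_nonneg)
    also have "\<dots> = (\<Sum>k\<in>J. (s k)\<^sup>2)"
      unfolding B_def by (rule sum.group) (use fin in \<open>auto simp: M_def\<close>)
    also have "\<dots> \<le> (\<Sum>k<N. (s k)\<^sup>2)" by (rule sum_mono2) (auto simp: J_def)
    finally show ?thesis using s1 by simp
  qed
  \<comment> \<open>Each x_i is counted at most twice: in terms of the rescaled value w, membership
    in the m-th interval reads Q^m <= w < Q^(m+2), which leaves two choices of m.\<close>
  have zsum: "(\<Sum>m\<in>M. (z m)\<^sup>2) \<le> 2"
  proof -
    have "(\<Sum>m\<in>M. (z m)\<^sup>2) = (\<Sum>m\<in>M. \<Sum>i\<in>I m. (x i)\<^sup>2)" unfolding z_def by (simp add: sum_nonneg)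
    also have "\<dots> = (\<Sum>m\<in>M. \<Sum>i<N. if L m \<le> x i \<and> x i < U m then (x i)\<^sup>2 else 0)"
      unfolding I_def by (intro sum.cong refl sum.inter_filter) simp
    also have "\<dots> = (\<Sum>i<N. \<Sum>m\<in>M. if L m \<le> x i \<and> x i < U m then (x i)\<^sup>2 else 0)"
      by (rule sum.swap)
    also have "\<dots> = (\<Sum>i<N. card {m \<in> M. L m \<le> x i \<and> x i < U m} * (x i)\<^sup>2)"
      using fin by (simp add: sum.inter_filter[symmetric])
    also have "\<dots> \<le> (\<Sum>i<N. 2 * (x i)\<^sup>2)"
    proof (intro sum_mono mult_right_mono)
      fix i
      have "card {m \<in> M. L m \<le> x i \<and> x i < U m} \<le> 2"
      proof (rule card_ints_half_open_interval_le_2)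
        fix m assume "m \<in> {m \<in> M. L m \<le> x i \<and> x i < U m}"
        then have m: "L m \<le> x i" "x i < U m" by auto
        define w where "w = 4 * \<beta> * x i / \<eta>"
        have "x i > 0" using m(1) L0[of m] by linarith
        then have w: "w > 0" unfolding w_def using \<eta> pos by simp
        have "Q powr of_int m \<le> w" using m(1) \<eta> pos unfolding L_def w_def by (simp add: field_simps)
        moreover have "w < Q powr (of_int m + 2)"
          using m(2) \<eta> pos unfolding UL L_def w_def by (simp add: field_simps powr_add)
        ultimately show "of_int m \<le> log Q w \<and> log Q w < of_int m + 2"
          using Q w by (simp add: le_log_iff log_less_iff)
      qed
      then show "real (card {m \<in> M. L m \<le> x i \<and> x i < U m}) \<le> 2" by simp
    qed auto
    finally show ?thesis using x1 by (simp add: sum_distrib_left[symmetric])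
  qed
  have "(\<Sum>k<N. \<Sum>i<N. g k i) = (\<Sum>k\<in>J. \<Sum>i<N. g k i)"
    by (rule sum.mono_neutral_right) (auto simp: J_def g_def)
  also have "\<dots> = (\<Sum>m\<in>M. \<Sum>k\<in>B m. \<Sum>i<N. g k i)"
    unfolding B_def by (rule sum.group[symmetric]) (use fin in \<open>auto simp: M_def\<close>)
  \<comment> \<open>Within a block the cut depends only on m and no longer on k, so one truncated
    vector serves all its rows and \<open>dual\<close> applies.\<close>
  also have "\<dots> = (\<Sum>m\<in>M. \<Sum>k\<in>B m. \<Sum>i<N. of_real (s k * (if i \<in> I m then x i else 0)) * t k i)"
    by (intro sum.cong refl) (auto simp: B_def J_def g_def f_def)
  finally have "cmod (\<Sum>k<N. \<Sum>i<N. g k i) \<le>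
      (\<Sum>m\<in>M. cmod (\<Sum>k\<in>B m. \<Sum>i<N. of_real (s k * (if i \<in> I m then x i else 0)) * t k i))"
    by (simp only: norm_sum)
  also have "\<dots> \<le> (\<Sum>m\<in>M. K * S * (((c m)\<^sup>2 + (z m)\<^sup>2) / 2))"
  proof (rule sum_mono)
    fix m
    \<comment> \<open>The exponent 2 of the ratio cancels the half in \<open>level_bound\<close>,
      which leaves exactly S.\<close>
    have "ln (U m / L m) / 2 = ln Q" unfolding UL using L0[of m] Q by (simp add: ln_realpow)
    moreover have "p (\<lambda>i. if i \<in> I m then x i else 0) \<le>
        K * sqrt (1 + ln (U m / L m) / 2) * sqrt (\<Sum>i\<in>I m. (x i)\<^sup>2)"
      by (rule level_bound[OF _ L0 LU]) (auto simp: I_def)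
    ultimately have p: "p (\<lambda>i. if i \<in> I m then x i else 0) \<le> K * S * z m"
      unfolding S_def z_def by (simp only:)
    have c0: "c m \<ge> 0" unfolding c_def by (simp add: sum_nonneg)
    have "cmod (\<Sum>k\<in>B m. \<Sum>i<N. of_real (s k * (if i \<in> I m then x i else 0)) * t k i)
       \<le> c m * p (\<lambda>i. if i \<in> I m then x i else 0)"
      unfolding c_def by (rule dual) (auto simp: B_def J_def)
    also have "\<dots> \<le> c m * (K * S * z m)" by (rule mult_left_mono[OF p c0])
    also have "\<dots> = K * S * (c m * z m)" by simp
    also have "\<dots> \<le> K * S * (((c m)\<^sup>2 + (z m)\<^sup>2) / 2)"
      by (rule mult_left_mono) (use K_nonneg S0 sum_squares_bound[of "c m" "z m"] in auto)
    finally show "cmod (\<Sum>k\<in>B m. \<Sum>i<N. of_real (s k * (if i \<in> I m then x i else 0)) * t k i)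
       \<le> K * S * (((c m)\<^sup>2 + (z m)\<^sup>2) / 2)" .
  qed
  also have "\<dots> = K * S * (((\<Sum>m\<in>M. (c m)\<^sup>2) + (\<Sum>m\<in>M. (z m)\<^sup>2)) / 2)"
    by (simp add: sum.distrib sum_distrib_left[symmetric] sum_divide_distrib[symmetric])
  also have "\<dots> \<le> K * S * (3 / 2)"
    by (rule mult_left_mono) (use csum zsum K_nonneg S0 in auto)
  finally have inside: "cmod (\<Sum>k<N. \<Sum>i<N. g k i) \<le> K * S * (3 / 2)" .

  \<comment> \<open>The discarded part costs \<eta> / 2, which is absorbed on the left; the 3/2 from
    (1 + 2) / 2 then doubles to 3.\<close>
  have "\<eta> = cmod ((\<Sum>k<N. \<Sum>i<N. f k i - g k i) + (\<Sum>k<N. \<Sum>i<N. g k i))"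
    unfolding \<eta>_def f_def by (simp add: sum.distrib[symmetric])
  also have "\<dots> \<le> \<eta> / 2 + K * S * (3 / 2)"
    using norm_triangle_ineq outside inside by (meson add_mono order_trans)
  finally show "\<eta> \<le> 3 * K * sqrt (1 + ln (16 * \<alpha> * \<beta> / \<eta>\<^sup>2))"
    unfolding S_def Q_def by simp
qed

section \<open>Spectral theorem for Hermitian matrices\<close>

lemma mat_adjoint_dim [simp]:
  "dim_row (mat_adjoint A) = dim_col A" "dim_col (mat_adjoint A) = dim_row A"
  unfolding mat_adjoint_def by auto

lemma mat_adjoint_carrier [simp]:
  "A \<in> carrier_mat n m \<Longrightarrow> mat_adjoint A \<in> carrier_mat m n"
  unfolding carrier_mat_def by simp

lemma mat_adjoint_index [simp]:
  fixes A :: "complex mat"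
  shows "i < dim_col A \<Longrightarrow> j < dim_row A \<Longrightarrow> mat_adjoint A $$ (i, j) = cnj (A $$ (j, i))"
  unfolding mat_adjoint_def by (simp add: mat_of_rows_index)

lemma index_mult_mat_sum:
  assumes "A \<in> carrier_mat n m" "B \<in> carrier_mat m l" "i < n" "j < l"
  shows "(A * B) $$ (i, j) = (\<Sum>k<m. A $$ (i, k) * B $$ (k, j))"
  using assms by (auto simp: scalar_prod_def lessThan_atLeast0 intro!: sum.cong)

lemma mult_square_carrier [simp]:
  "A \<in> carrier_mat n n \<Longrightarrow> B \<in> carrier_mat n n \<Longrightarrow> A * B \<in> carrier_mat n n"
  by (rule mult_carrier_mat)

lemma mat_adjoint_mult:
  fixes A :: "complex mat"
  assumes "A \<in> carrier_mat n m" "B \<in> carrier_mat m l"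
  shows "mat_adjoint (A * B) = mat_adjoint B * mat_adjoint A"
proof (rule eq_matI)
  fix i j assume "i < dim_row (mat_adjoint B * mat_adjoint A)" "j < dim_col (mat_adjoint B * mat_adjoint A)"
  then have ij: "i < l" "j < n" using assms by auto
  have "mat_adjoint (A * B) $$ (i, j) = cnj ((A * B) $$ (j, i))"
    using assms ij by (intro mat_adjoint_index) auto
  also have "\<dots> = (\<Sum>k<m. cnj (B $$ (k, i)) * cnj (A $$ (j, k)))"
    by (simp add: index_mult_mat_sum[OF assms ij(2,1)] mult.commute)
  also have "\<dots> = (mat_adjoint B * mat_adjoint A) $$ (i, j)"
    using assms ij by (subst index_mult_mat_sum[of _ l m _ n]) (auto intro!: sum.cong)
  finally show "mat_adjoint (A * B) $$ (i, j) = (mat_adjoint B * mat_adjoint A) $$ (i, j)" .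
qed (use assms in auto)

lemma mat_adjoint_adjoint [simp]:
  fixes A :: "complex mat" shows "mat_adjoint (mat_adjoint A) = A"
  by (rule eq_matI) auto

definition unitary_mat :: "nat \<Rightarrow> complex mat \<Rightarrow> bool" where
  "unitary_mat n W \<longleftrightarrow> W \<in> carrier_mat n n \<and> mat_adjoint W * W = 1\<^sub>m n"

lemma unitary_matD:
  assumes "unitary_mat n W"
  shows "W \<in> carrier_mat n n" "mat_adjoint W * W = 1\<^sub>m n" "W * mat_adjoint W = 1\<^sub>m n"
  using assms mat_mult_left_right_inverse[of "mat_adjoint W" n W] unfolding unitary_mat_def by auto

lemma unitary_mat_adjoint:
  assumes "unitary_mat n W"
  shows "unitary_mat n (mat_adjoint W)"
  using unitary_matD(1,3)[OF assms] unfolding unitary_mat_def by simp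

lemma unitary_mat_mult:
  assumes "unitary_mat n V" "unitary_mat n W"
  shows "unitary_mat n (V * W)"
proof -
  note V = unitary_matD[OF assms(1)] and W = unitary_matD[OF assms(2)]
  have "mat_adjoint (V * W) * (V * W) = mat_adjoint W * mat_adjoint V * (V * W)"
    using V W by (simp add: mat_adjoint_mult[of _ n n])
  also have "\<dots> = mat_adjoint W * (mat_adjoint V * V) * W"
    using V(1) W(1) by (simp add: assoc_mult_mat[of _ n n _ n _ n])
  finally show ?thesis using V W by (simp add: unitary_mat_def)
qed

lemma unitary_col_sum:
  assumes "unitary_mat n W" "i < n" "j < n"
  shows "(\<Sum>p<n. cnj (W $$ (p, i)) * W $$ (p, j)) = (if i = j then 1 else 0)"
proof -
  note W = unitary_matD[OF assms(1)]
  have "(\<Sum>p<n. cnj (W $$ (p, i)) * W $$ (p, j)) = (mat_adjoint W * W) $$ (i, j)"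
    using W(1) assms(2,3) by (subst index_mult_mat_sum[of _ n n _ n]) (auto intro!: sum.cong)
  then show ?thesis using W(2) assms by simp
qed

lemma unitary_row_sum:
  assumes "unitary_mat n W" "i < n" "j < n"
  shows "(\<Sum>p<n. W $$ (i, p) * cnj (W $$ (j, p))) = (if i = j then 1 else 0)"
proof -
  note W = unitary_matD[OF assms(1)]
  have "(\<Sum>p<n. W $$ (i, p) * cnj (W $$ (j, p))) = (W * mat_adjoint W) $$ (i, j)"
    using W(1) assms(2,3) by (subst index_mult_mat_sum[of _ n n _ n]) (auto intro!: sum.cong)
  then show ?thesis using W(3) assms by simp
qed

definition diagonal_in :: "nat \<Rightarrow> complex mat \<Rightarrow> (nat \<Rightarrow> complex) \<Rightarrow> complex mat" where
  "diagonal_in n W a = W * mat n n (\<lambda>(i, j). if i = j then a i else 0) * mat_adjoint W"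

lemma diagonal_in_carrier [simp]:
  "W \<in> carrier_mat n n \<Longrightarrow> diagonal_in n W a \<in> carrier_mat n n"
  unfolding diagonal_in_def by simp

lemma diagonal_in_dim [simp]:
  "dim_row (diagonal_in n W a) = dim_row W" "dim_col (diagonal_in n W a) = dim_row W"
  unfolding diagonal_in_def by simp_all

lemma diagonal_in_index:
  assumes "W \<in> carrier_mat n n" "p < n" "q < n"
  shows "diagonal_in n W a $$ (p, q) = (\<Sum>i<n. a i * (W $$ (p, i) * cnj (W $$ (q, i))))"
proof -
  let ?D = "mat n n (\<lambda>(i, j). if i = j then a i else 0)"
  have WD: "(W * ?D) $$ (p, i) = W $$ (p, i) * a i" if "i < n" for i
    using assms that
    by (subst index_mult_mat_sum[of _ n n _ n]) (auto simp: if_distrib cong: if_cong)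
  have "W * ?D \<in> carrier_mat n n" using assms by auto
  then have "diagonal_in n W a $$ (p, q) = (\<Sum>i<n. (W * ?D) $$ (p, i) * mat_adjoint W $$ (i, q))"
    unfolding diagonal_in_def using assms by (intro index_mult_mat_sum) auto
  also have "\<dots> = (\<Sum>i<n. a i * (W $$ (p, i) * cnj (W $$ (q, i))))"
    using assms by (intro sum.cong refl) (simp add: WD del: index_mult_mat(1))
  finally show ?thesis .
qed

text \<open>Gram-Schmidt applied to a basis that starts with v leaves its first vector
  unchanged.\<close>

lemma corthogonal_completion:
  fixes v :: "complex vec"
  assumes v: "v \<in> carrier_vec n" "v \<noteq> 0\<^sub>v n"
  shows "\<exists>ws. set ws \<subseteq> carrier_vec n \<and> corthogonal ws \<and> length ws = n \<and> hd ws = v"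
proof -
  define b where "b = basis_completion v"
  interpret cof_vec_space n "TYPE(complex)" .
  from basis_completion[OF v, folded b_def]
  have b: "distinct b" "\<not> lin_dep (set b)" "set b \<subseteq> carrier_vec n" "hd b = v" "length b = n" by auto
  have "n \<noteq> 0" using v by auto
  with b obtain vs where bv: "b = v # vs" by (cases b) auto
  from gram_schmidt_result[OF b(3,1,2) refl] gram_schmidt_hd[OF v(1), of vs, folded bv] b(5)
  show ?thesis by metis
qed

text \<open>Normalising an orthogonal basis that begins with v gives the columns of W; the scalar c
  is the reciprocal length of v.\<close>

lemma exists_unitary_with_first_column:
  fixes v :: "complex vec"
  assumes v: "v \<in> carrier_vec (Suc n)" "v \<noteq> 0\<^sub>v (Suc n)"
  shows "\<exists>W c. unitary_mat (Suc n) W \<and> (\<forall>i\<le>n. W $$ (i, 0) = c * v $ i)"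
proof -
  let ?n = "Suc n"
  obtain ws where ws: "set ws \<subseteq> carrier_vec ?n" "corthogonal ws" "length ws = ?n" "hd ws = v"
    using corthogonal_completion[OF v] by blast
  then have ws0: "ws ! 0 = v" by (cases ws) auto
  have wsc: "ws ! j \<in> carrier_vec ?n" if "j < ?n" for j
    using ws(1) nth_mem[of j ws] that unfolding ws(3) by blast
  have prod: "ws ! i \<bullet>c ws ! j = (\<Sum>p<?n. ws ! i $ p * cnj (ws ! j $ p))" if "i < ?n" "j < ?n" for i j
    using wsc[OF that(1)] wsc[OF that(2)] by (auto simp: scalar_prod_def lessThan_atLeast0 intro!: sum.cong)
  define r where "r j = (\<Sum>i<?n. (cmod (ws ! j $ i))\<^sup>2)" for j
  have prod: "ws ! i \<bullet>c ws ! j = (\<Sum>p<?n. ws ! i $ p * cnj (ws ! j $ p))" if "i < ?n" "j < ?n" for i j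
    using wsc[OF that(1)] wsc[OF that(2)] by (auto simp: scalar_prod_def lessThan_atLeast0 intro!: sum.cong)
  have r: "of_real (r j) = (\<Sum>p<?n. cnj (ws ! j $ p) * ws ! j $ p)" for j
    unfolding r_def of_real_sum by (intro sum.cong refl) (metis complex_norm_square mult.commute of_real_power)
  have r0: "r j > 0" if "j < ?n" for j
  proof -
    have "complex_of_real (r j) \<noteq> 0"
      unfolding r using corthogonalD[OF ws(2), of j j] ws(3) that prod[OF that that] by (simp only: mult.commute not_True_eq_False simp_thms)
    moreover have "r j \<ge> 0" unfolding r_def by (simp add: sum_nonneg)
    ultimately show ?thesis by (simp add: less_le)
  qed
  define W where "W = mat ?n ?n (\<lambda>(i, j). of_real (1 / sqrt (r j)) * ws ! j $ i)"
  have W: "W \<in> carrier_mat ?n ?n" unfolding W_def by simp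
  have "mat_adjoint W * W = 1\<^sub>m ?n"
  proof (rule eq_matI)
    fix i j assume "i < dim_row (1\<^sub>m ?n)" "j < dim_col (1\<^sub>m ?n)"
    then have ij: "i < ?n" "j < ?n" by auto
    have "(mat_adjoint W * W) $$ (i, j) = (\<Sum>p<?n. cnj (W $$ (p, i)) * W $$ (p, j))"
      using W ij by (subst index_mult_mat_sum[of _ ?n ?n _ ?n]) (auto intro!: sum.cong)
    also have "\<dots> = (\<Sum>p<?n. of_real (1 / sqrt (r i) * (1 / sqrt (r j))) * (cnj (ws ! i $ p) * ws ! j $ p))"
      unfolding W_def using ij by (intro sum.cong refl) (simp add: mult_ac)
    also have "\<dots> = of_real (1 / sqrt (r i) * (1 / sqrt (r j))) * (\<Sum>p<?n. cnj (ws ! i $ p) * ws ! j $ p)"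
      by (simp only: sum_distrib_left)
    also have "\<dots> = (if i = j then 1 else 0)"
    proof (cases "i = j")
      case True
      have "1 / sqrt (r j) * (1 / sqrt (r j)) * r j = 1" using r0[OF ij(2)] by (simp add: field_simps)
      then have "of_real (1 / sqrt (r j) * (1 / sqrt (r j))) * complex_of_real (r j) = 1"
        by (metis of_real_1 of_real_mult)
      then show ?thesis using True unfolding r by simp
    next
      case False
      then have "(\<Sum>p<?n. cnj (ws ! i $ p) * ws ! j $ p) = 0"
        using corthogonalD[OF ws(2), of j i] ws(3) ij prod[OF ij(2,1)] by (simp add: mult.commute)
      then show ?thesis using False by simp
    qed
    finally show "(mat_adjoint W * W) $$ (i, j) = 1\<^sub>m ?n $$ (i, j)" using ij by simp
  qed (use W in simp_all)
  then have Wu: "unitary_mat ?n W" using W unfolding unitary_mat_def by simp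
  have W0: "W $$ (i, 0) = of_real (1 / sqrt (r 0)) * v $ i" if "i \<le> n" for i
    using that ws0 unfolding W_def by simp
  show ?thesis using Wu W0 by blast
qed

text \<open>Deflation: in a unitary basis that starts with an eigenvector the first column of the
  matrix is (e, 0, ..., 0), and by symmetry so is the first row up to conjugation. The remaining
  block is Hermitian of size n and is diagonalised by induction.\<close>

lemma hermitian_diagonalization:
  assumes "A \<in> carrier_mat n n" "mat_adjoint A = A"
  shows "\<exists>W d. unitary_mat n W \<and> A = diagonal_in n W (\<lambda>i. complex_of_real (d i))"
  using assms
proof (induction n arbitrary: A)
  case 0
  have "mat_adjoint (1\<^sub>m 0) * 1\<^sub>m 0 = (1\<^sub>m 0 :: complex mat)" by (rule eq_matI) simp_all
  then have "unitary_mat 0 (1\<^sub>m 0)" unfolding unitary_mat_def by simp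
  moreover have "A = diagonal_in 0 (1\<^sub>m 0) (\<lambda>i. complex_of_real (undefined i))"
    by (rule eq_matI) (use 0 in \<open>simp_all add: diagonal_in_def\<close>)
  ultimately show ?case by blast
next
  case (Suc n)
  let ?n = "Suc n"
  note A = Suc.prems
  obtain as where as: "char_poly A = (\<Prod>a\<leftarrow>as. [:- a, 1:])" "length as = ?n"
    using char_poly_factorized[OF A(1)] by blast
  then obtain e es where "as = e # es" by (cases as) auto
  then have "eigenvalue A e" unfolding eigenvalue_root_char_poly[OF A(1)] as by simp
  then obtain v where v: "v \<in> carrier_vec ?n" "v \<noteq> 0\<^sub>v ?n" "A *\<^sub>v v = e \<cdot>\<^sub>v v"
    using A(1) unfolding eigenvalue_def eigenvector_def by auto
  obtain W c where W: "unitary_mat ?n W" "\<And>i. i \<le> n \<Longrightarrow> W $$ (i, 0) = c * v $ i"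
    using exists_unitary_with_first_column[OF v(1,2)] by blast
  note Wu = unitary_matD[OF W(1)]
  define B where "B = mat_adjoint W * A * W"
  have B: "B \<in> carrier_mat ?n ?n" using Wu A unfolding B_def by simp
  have BH: "mat_adjoint B = B"
    unfolding B_def using Wu A
    by (simp add: mat_adjoint_mult[of _ ?n ?n _ ?n] assoc_mult_mat[of _ ?n ?n _ ?n _ ?n])
  then have Bsym: "B $$ (j, i) = cnj (B $$ (i, j))" if "i \<le> n" "j \<le> n" for i j
    using mat_adjoint_index[of j B i] B that by simp
  have AW: "(A * W) $$ (i, 0) = e * W $$ (i, 0)" if "i \<le> n" for i
  proof -
    have "(A * W) $$ (i, 0) = (\<Sum>k<?n. A $$ (i, k) * W $$ (k, 0))"
      using A Wu that by (intro index_mult_mat_sum) auto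
    also have "\<dots> = c * (\<Sum>k<?n. A $$ (i, k) * v $ k)"
      unfolding sum_distrib_left by (intro sum.cong refl) (simp add: W(2))
    also have "(\<Sum>k<?n. A $$ (i, k) * v $ k) = (A *\<^sub>v v) $ i"
      using A(1) v(1) that by (auto simp: scalar_prod_def lessThan_atLeast0 intro!: sum.cong)
    also have "\<dots> = e * v $ i" using v that by auto
    finally show ?thesis using W(2)[OF that] by simp
  qed
  have B0: "B $$ (i, 0) = (if i = 0 then e else 0)" if "i \<le> n" for i
  proof -
    have "B = mat_adjoint W * (A * W)"
      unfolding B_def using Wu A by (simp add: assoc_mult_mat[of _ ?n ?n _ ?n _ ?n])
    then have "B $$ (i, 0) = (\<Sum>k<?n. mat_adjoint W $$ (i, k) * (A * W) $$ (k, 0))"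
      using Wu A that by (simp only:) (rule index_mult_mat_sum, auto)
    also have "\<dots> = e * (\<Sum>k<?n. cnj (W $$ (k, i)) * W $$ (k, 0))"
      unfolding sum_distrib_left using Wu(1) that
      by (intro sum.cong refl) (simp add: AW del: index_mult_mat(1))
    finally show ?thesis using unitary_col_sum[OF W(1), of i 0] that by simp
  qed
  have B0': "B $$ (0, i) = (if i = 0 then cnj e else 0)" if "i \<le> n" for i
    using Bsym[of i 0] B0[OF that] that by simp
  \<comment> \<open>The corner entry, read as part of the first column and of the first row, equals
    both e and its conjugate, so e is real.\<close>
  have e: "complex_of_real (Re e) = e" using B0[of 0] B0'[of 0] by (metis Reals_cnj_iff le0 of_real_Re)
  define B' where "B' = mat n n (\<lambda>(i, j). B $$ (Suc i, Suc j))"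
  have B'c: "B' \<in> carrier_mat n n" unfolding B'_def by simp
  have "mat_adjoint B' = B'"
    by (rule eq_matI) (auto simp: B'_def Bsym[symmetric])
  then obtain W' d where W': "unitary_mat n W'" "B' = diagonal_in n W' (\<lambda>i. complex_of_real (d i))"
    using Suc.IH[OF B'c] by blast
  \<comment> \<open>The block sum of 1 and W', with index shift; \<open>f\<close> puts the
    eigenvalue e in front of the eigenvalues d of the block.\<close>
  define U where "U = mat ?n ?n (\<lambda>(i, j). if i = 0 \<or> j = 0 then (if i = j then 1 else 0) else W' $$ (i - 1, j - 1))"
  define f where "f i = (case i of 0 \<Rightarrow> Re e | Suc i \<Rightarrow> d i)" for i
  have U: "U \<in> carrier_mat ?n ?n" unfolding U_def by simp
  have Uu: "unitary_mat ?n U"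
    unfolding unitary_mat_def
  proof (intro conjI U eq_matI)
    fix i j assume "i < dim_row (1\<^sub>m ?n)" "j < dim_col (1\<^sub>m ?n)"
    then have ij: "i < ?n" "j < ?n" by auto
    have "(mat_adjoint U * U) $$ (i, j) = (\<Sum>p<?n. cnj (U $$ (p, i)) * U $$ (p, j))"
      using U ij by (subst index_mult_mat_sum[of _ ?n ?n _ ?n]) (auto intro!: sum.cong)
    also have "\<dots> = (if i = j then 1 else 0)"
      using ij unitary_col_sum[OF W'(1), of "i - 1" "j - 1"] unfolding sum.lessThan_Suc_shift U_def
      by (cases i; cases j) auto
    finally show "(mat_adjoint U * U) $$ (i, j) = 1\<^sub>m ?n $$ (i, j)" using ij by simp
  qed (use U in auto)
  have BU: "B = diagonal_in ?n U (\<lambda>i. complex_of_real (f i))"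
  proof (rule eq_matI)
    fix p q assume "p < dim_row (diagonal_in ?n U (\<lambda>i. complex_of_real (f i)))"
      "q < dim_col (diagonal_in ?n U (\<lambda>i. complex_of_real (f i)))"
    then have pq: "p < ?n" "q < ?n" using U by auto
    have inner: "B $$ (Suc p', Suc q') = (\<Sum>i<n. complex_of_real (d i) * (W' $$ (p', i) * cnj (W' $$ (q', i))))"
      if "p' < n" "q' < n" for p' q'
    proof -
      have "B $$ (Suc p', Suc q') = B' $$ (p', q')" using that unfolding B'_def by simp
      then show ?thesis unfolding W'(2) diagonal_in_index[OF unitary_matD(1)[OF W'(1)] that] .
    qed
    show "B $$ (p, q) = diagonal_in ?n U (\<lambda>i. complex_of_real (f i)) $$ (p, q)"
      unfolding diagonal_in_index[OF U pq] sum.lessThan_Suc_shift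
      using pq by (cases p; cases q) (auto simp: U_def f_def B0 B0' e inner)
  qed (use B U in auto)
  have "A = (W * mat_adjoint W) * A * (W * mat_adjoint W)"
    using Wu A by simp
  also have "\<dots> = W * B * mat_adjoint W"
    unfolding B_def using Wu(1) A by (simp add: assoc_mult_mat[of _ ?n ?n _ ?n _ ?n])
  also have "\<dots> = diagonal_in ?n (W * U) (\<lambda>i. complex_of_real (f i))"
    unfolding BU diagonal_in_def using Wu(1) U
    by (simp add: assoc_mult_mat[of _ ?n ?n _ ?n _ ?n] mat_adjoint_mult[of _ ?n ?n _ ?n])
  finally show ?case using unitary_mat_mult[OF W(1) Uu] by blast
qed

section \<open>Singular values and Schatten norms\<close>

lemma diagonal_in_mult:
  assumes "unitary_mat n W"
  shows "diagonal_in n W a * diagonal_in n W b = diagonal_in n W (\<lambda>i. a i * b i)"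
proof -
  note W = unitary_matD[OF assms]
  let ?D = "\<lambda>a. mat n n (\<lambda>(i, j). if i = j then a i else 0) :: complex mat"
  have D: "?D a \<in> carrier_mat n n" for a by simp
  have prod: "?D a * ?D b = ?D (\<lambda>i. a i * b i)"
  proof (rule eq_matI)
    fix i j assume "i < dim_row (?D (\<lambda>i. a i * b i))" "j < dim_col (?D (\<lambda>i. a i * b i))"
    then have ij: "i < n" "j < n" by auto
    have "(?D a * ?D b) $$ (i, j) = (\<Sum>k<n. ?D a $$ (i, k) * ?D b $$ (k, j))"
      by (rule index_mult_mat_sum[OF D D ij])
    also have "\<dots> = (\<Sum>k<n. if k = i then a i * (if i = j then b i else 0) else 0)"
      using ij by (intro sum.cong refl) auto
    finally show "(?D a * ?D b) $$ (i, j) = ?D (\<lambda>i. a i * b i) $$ (i, j)" using ij by simp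
  qed auto
  have "diagonal_in n W a * diagonal_in n W b = W * ?D a * (mat_adjoint W * W) * ?D b * mat_adjoint W"
    unfolding diagonal_in_def using W(1) D by (simp add: assoc_mult_mat[of _ n n _ n _ n])
  also have "\<dots> = W * (?D a * ?D b) * mat_adjoint W"
    unfolding W(2) using W(1) D by (simp add: assoc_mult_mat[of _ n n _ n _ n])
  finally show ?thesis unfolding prod diagonal_in_def .
qed

lemma diagonal_in_adjoint:
  assumes "W \<in> carrier_mat n n"
  shows "mat_adjoint (diagonal_in n W a) = diagonal_in n W (\<lambda>i. cnj (a i))"
proof (rule eq_matI)
  fix i j assume "i < dim_row (diagonal_in n W (\<lambda>i. cnj (a i)))" "j < dim_col (diagonal_in n W (\<lambda>i. cnj (a i)))"
  then have ij: "i < n" "j < n" using assms by auto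
  have "mat_adjoint (diagonal_in n W a) $$ (i, j) = cnj (diagonal_in n W a $$ (j, i))"
    using assms ij by (intro mat_adjoint_index) auto
  then show "mat_adjoint (diagonal_in n W a) $$ (i, j) = diagonal_in n W (\<lambda>i. cnj (a i)) $$ (i, j)"
    using assms ij by (simp add: diagonal_in_index mult_ac)
qed (use assms in auto)

text \<open>Similar matrices share their characteristic polynomial, so any unitary diagonalisation
  of A* A lists the roots with multiplicity. This connects the definition through
  \<open>proots\<close> to explicit decompositions.\<close>

lemma singular_values_eq:
  assumes "unitary_mat n W" "mat_adjoint A * A = diagonal_in n W (\<lambda>i. complex_of_real (d i))"
  shows "singular_values A = image_mset (\<lambda>i. sqrt (d i)) (mset_set {..<n})"
proof -
  note W = unitary_matD[OF assms(1)]
  let ?D = "mat n n (\<lambda>(i, j). if i = j then complex_of_real (d i) else 0)"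
  have "similar_mat_wit (mat_adjoint A * A) ?D W (mat_adjoint W)"
    by (rule similar_mat_witI[of _ _ n])
      (use W assms(2) in \<open>auto simp: diagonal_in_def[symmetric]\<close>)
  then have "char_poly (mat_adjoint A * A) = char_poly ?D"
    by (intro char_poly_similar) (auto simp: similar_mat_def)
  also have "\<dots> = (\<Prod>a\<leftarrow>diag_mat ?D. [:- a, 1:])"
    by (rule char_poly_upper_triangular) auto
  also have "diag_mat ?D = map (\<lambda>i. complex_of_real (d i)) [0..<n]"
    by (auto simp: diag_mat_def)
  finally have "char_poly (mat_adjoint A * A) = (\<Prod>a\<leftarrow>map (\<lambda>i. complex_of_real (d i)) [0..<n]. [:- a, 1:])" .
  moreover have "proots (\<Prod>a\<leftarrow>xs. [:- a, 1:]) = mset xs" for xs :: "complex list"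
  proof (induction xs)
    case (Cons a xs)
    have "(\<Prod>a\<leftarrow>xs. [:- a, 1:]) \<noteq> (0 :: complex poly)" by (auto simp: prod_list_zero_iff)
    then show ?case using Cons proots_mult[of "[:- a, 1:]" "\<Prod>a\<leftarrow>xs. [:- a, 1:]"] by simp
  qed simp
  ultimately have "proots (char_poly (mat_adjoint A * A)) = mset (map (\<lambda>i. complex_of_real (d i)) [0..<n])"
    by (simp only:)
  then show ?thesis
    unfolding singular_values_def by (simp add: multiset.map_comp comp_def lessThan_atLeast0)
qed

section \<open>Pythagoras, the Frobenius norm and singular value decompositions\<close>

lemma cmod_square_eq: "complex_of_real ((cmod z)\<^sup>2) = cnj z * z"
  by (metis complex_norm_square mult.commute of_real_power)

text \<open>Pythagoras: expanding the square, orthogonality of the columns kills all mixed terms.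
  The r_j are squared lengths and may be 0, as happens for a matrix A V with vanishing singular
  values.\<close>

lemma sum_norm_orthogonal:
  fixes m n :: nat
  assumes "\<And>j l. j < m \<Longrightarrow> l < m \<Longrightarrow>
    (\<Sum>p<n. cnj (B p j) * B p l) = (if j = l then complex_of_real (r j) else 0)"
  shows "(\<Sum>p<n. (cmod (\<Sum>j<m. B p j * x j))\<^sup>2) = (\<Sum>j<m. r j * (cmod (x j))\<^sup>2)"
proof -
  have "complex_of_real (\<Sum>p<n. (cmod (\<Sum>j<m. B p j * x j))\<^sup>2)
    = (\<Sum>p<n. cnj (\<Sum>j<m. B p j * x j) * (\<Sum>l<m. B p l * x l))"
    unfolding of_real_sum cmod_square_eq ..
  also have "\<dots> = (\<Sum>p<n. \<Sum>j<m. \<Sum>l<m. (cnj (x j) * x l) * (cnj (B p j) * B p l))"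
    unfolding cnj_sum complex_cnj_mult sum_product by (intro sum.cong refl) (simp add: mult_ac)
  also have "\<dots> = (\<Sum>j<m. \<Sum>p<n. \<Sum>l<m. (cnj (x j) * x l) * (cnj (B p j) * B p l))"
    by (rule sum.swap)
  also have "\<dots> = (\<Sum>j<m. \<Sum>l<m. \<Sum>p<n. (cnj (x j) * x l) * (cnj (B p j) * B p l))"
    by (intro sum.cong refl sum.swap)
  also have "\<dots> = (\<Sum>j<m. \<Sum>l<m. (cnj (x j) * x l) * (if j = l then complex_of_real (r j) else 0))"
    by (intro sum.cong refl) (simp add: sum_distrib_left[symmetric] assms)
  also have "\<dots> = (\<Sum>j<m. complex_of_real (r j * (cmod (x j))\<^sup>2))"
  proof (rule sum.cong[OF refl])
    fix j assume "j \<in> {..<m}"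
    then have "(\<Sum>l<m. (cnj (x j) * x l) * (if j = l then complex_of_real (r j) else 0)) =
        (\<Sum>l\<in>{j}. (cnj (x j) * x l) * (if j = l then complex_of_real (r j) else 0))"
      by (intro sum.mono_neutral_right) auto
    then show "(\<Sum>l<m. (cnj (x j) * x l) * (if j = l then complex_of_real (r j) else 0)) =
        complex_of_real (r j * (cmod (x j))\<^sup>2)"
      unfolding of_real_mult cmod_square_eq by simp
  qed
  finally show ?thesis unfolding of_real_sum[symmetric] of_real_eq_iff .
qed

text \<open>Entrywise form of the Schatten 2-norm (\<open>schatten_2_eq_frobenius\<close>); the
  triangle inequality and homogeneity are inherited from \<open>L2_set\<close>, whereas they are not
  visible on singular values.\<close>

definition frobenius_norm :: "nat \<Rightarrow> complex mat \<Rightarrow> real" where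
  "frobenius_norm n A = L2_set (\<lambda>(p, q). cmod (A $$ (p, q))) ({..<n} \<times> {..<n})"

lemma frobenius_norm_nonneg [simp]: "frobenius_norm n A \<ge> 0"
  unfolding frobenius_norm_def by simp

lemma frobenius_norm_square:
  "(frobenius_norm n A)\<^sup>2 = (\<Sum>p<n. \<Sum>q<n. (cmod (A $$ (p, q)))\<^sup>2)"
  unfolding frobenius_norm_def L2_set_def
  by (simp add: sum_nonneg sum.cartesian_product case_prod_unfold)

lemma frobenius_norm_eqI:
  assumes "(frobenius_norm n A)\<^sup>2 = r"
  shows "frobenius_norm n A = sqrt r"
  using assms by (simp add: real_sqrt_unique)

lemma frobenius_norm_mult_unitary:
  assumes "A \<in> carrier_mat n n" "unitary_mat n V"
  shows "frobenius_norm n (A * V) = frobenius_norm n A"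
proof -
  have "(frobenius_norm n (A * V))\<^sup>2 = (\<Sum>p<n. \<Sum>q<n. (cmod (\<Sum>j<n. V $$ (j, q) * A $$ (p, j)))\<^sup>2)"
    unfolding frobenius_norm_square using assms unitary_matD(1)[OF assms(2)]
    by (intro sum.cong refl) (simp add: index_mult_mat_sum[of _ n n _ n] mult.commute del: index_mult_mat(1))
  also have "\<dots> = (\<Sum>p<n. \<Sum>j<n. 1 * (cmod (A $$ (p, j)))\<^sup>2)"
  proof (rule sum.cong[OF refl])
    fix p
    show "(\<Sum>q<n. (cmod (\<Sum>j<n. V $$ (j, q) * A $$ (p, j)))\<^sup>2) = (\<Sum>j<n. 1 * (cmod (A $$ (p, j)))\<^sup>2)"
    proof (rule sum_norm_orthogonal)
      fix j l assume "j < n" "l < n"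
      then show "(\<Sum>q<n. cnj (V $$ (j, q)) * V $$ (l, q)) = (if j = l then complex_of_real 1 else 0)"
        using unitary_row_sum[OF assms(2), of l j] by (auto simp: mult.commute)
    qed
  qed
  also have "\<dots> = (frobenius_norm n A)\<^sup>2" unfolding frobenius_norm_square by simp
  finally show ?thesis by simp
qed

text \<open>The right singular vectors are the columns of V; the left ones are the normalised
  columns of A V, which are pairwise orthogonal of length s_k. In this form no orthonormal
  completion is required where s_k = 0.\<close>

definition is_svd :: "nat \<Rightarrow> complex mat \<Rightarrow> complex mat \<Rightarrow> (nat \<Rightarrow> real) \<Rightarrow> bool" where
  "is_svd n A V s \<longleftrightarrow> unitary_mat n V \<and> (\<forall>k. s k \<ge> 0) \<and>
    (\<forall>k<n. \<forall>l<n. (\<Sum>p<n. cnj ((A * V) $$ (p, k)) * (A * V) $$ (p, l)) =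
      (if k = l then complex_of_real ((s k)\<^sup>2) else 0)) \<and>
    singular_values A = image_mset s (mset_set {..<n})"

lemma is_svdD:
  assumes "is_svd n A V s"
  shows "unitary_mat n V" "s k \<ge> 0"
    "k < n \<Longrightarrow> l < n \<Longrightarrow> (\<Sum>p<n. cnj ((A * V) $$ (p, k)) * (A * V) $$ (p, l)) =
      (if k = l then complex_of_real ((s k)\<^sup>2) else 0)"
    "singular_values A = image_mset s (mset_set {..<n})"
  using assms unfolding is_svd_def by blast+

text \<open>If V diagonalises A* A, then the Gram matrix of the columns of A V is that diagonal
  matrix, whose entries are therefore squared lengths.\<close>

lemma singular_value_decomposition:
  assumes A: "A \<in> carrier_mat n n"
  shows "\<exists>V s. is_svd n A V s"
proof -
  have "mat_adjoint (mat_adjoint A * A) = mat_adjoint A * A"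
    using A by (simp add: mat_adjoint_mult[of _ n n _ n])
  moreover have "mat_adjoint A * A \<in> carrier_mat n n" using A by simp
  ultimately obtain V d where V: "unitary_mat n V" and AA: "mat_adjoint A * A = diagonal_in n V (\<lambda>i. complex_of_real (d i))"
    using hermitian_diagonalization by blast
  note Vu = unitary_matD[OF V]
  let ?D = "mat n n (\<lambda>(i, j). if i = j then complex_of_real (d i) else 0)"
  have "mat_adjoint (A * V) * (A * V) = mat_adjoint V * (mat_adjoint A * A) * V"
    using A Vu(1) by (simp add: mat_adjoint_mult[of _ n n _ n] assoc_mult_mat[of _ n n _ n _ n])
  also have "\<dots> = (mat_adjoint V * V) * ?D * (mat_adjoint V * V)"
    unfolding AA diagonal_in_def using Vu(1) by (simp add: assoc_mult_mat[of _ n n _ n _ n])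
  also have "\<dots> = ?D" unfolding Vu(2) by simp
  finally have D: "mat_adjoint (A * V) * (A * V) = ?D" .
  have AV: "A * V \<in> carrier_mat n n" using A Vu(1) by simp
  have orth: "(\<Sum>p<n. cnj ((A * V) $$ (p, k)) * (A * V) $$ (p, l)) = (if k = l then complex_of_real (d k) else 0)"
    if "k < n" "l < n" for k l
  proof -
    have "(\<Sum>p<n. cnj ((A * V) $$ (p, k)) * (A * V) $$ (p, l)) = (mat_adjoint (A * V) * (A * V)) $$ (k, l)"
      unfolding index_mult_mat_sum[OF mat_adjoint_carrier[OF AV] AV that]
      using AV that A Vu(1) by (intro sum.cong refl) (simp del: index_mult_mat(1))
    then show ?thesis unfolding D using that by simp
  qed
  have d: "d k \<ge> 0" if "k < n" for k
  proof -
    have "complex_of_real (d k) = complex_of_real (\<Sum>p<n. (cmod ((A * V) $$ (p, k)))\<^sup>2)"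
      unfolding of_real_sum cmod_square_eq using orth[OF that that] by simp
    then have "d k = (\<Sum>p<n. (cmod ((A * V) $$ (p, k)))\<^sup>2)" unfolding of_real_eq_iff .
    then show ?thesis by (simp add: sum_nonneg)
  qed
  \<comment> \<open>The value 0 beyond n makes s nonnegative at every index, as
    \<open>is_svd\<close> asks.\<close>
  define s where "s k = (if k < n then sqrt (d k) else 0)" for k
  have "singular_values A = image_mset s (mset_set {..<n})"
    unfolding singular_values_eq[OF V AA] by (rule image_mset_cong) (simp add: s_def)
  moreover have "s k \<ge> 0" for k unfolding s_def using d by simp
  moreover have "(\<Sum>p<n. cnj ((A * V) $$ (p, k)) * (A * V) $$ (p, l)) = (if k = l then complex_of_real ((s k)\<^sup>2) else 0)"
    if "k < n" "l < n" for k l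
  proof -
    have "(s k)\<^sup>2 = d k" unfolding s_def using d[OF that(1)] that by simp
    then show ?thesis using orth[OF that] by (simp only:)
  qed
  ultimately show ?thesis using V unfolding is_svd_def by blast
qed

lemma orthogonal_column_norm:
  assumes "k < n" and "\<And>k l. k < n \<Longrightarrow> l < n \<Longrightarrow>
      (\<Sum>p<n. cnj (B $$ (p, k)) * B $$ (p, l)) = (if k = l then complex_of_real ((s k)\<^sup>2) else 0)"
  shows "(\<Sum>p<n. (cmod (B $$ (p, k)))\<^sup>2) = (s k)\<^sup>2"
proof -
  have "complex_of_real (\<Sum>p<n. (cmod (B $$ (p, k)))\<^sup>2) = complex_of_real ((s k)\<^sup>2)"
    unfolding of_real_sum cmod_square_eq using assms by simp
  then show ?thesis unfolding of_real_eq_iff .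
qed

lemma frobenius_norm_eq_singular_values:
  assumes "A \<in> carrier_mat n n" "unitary_mat n V" "\<And>k l. k < n \<Longrightarrow> l < n \<Longrightarrow>
      (\<Sum>p<n. cnj ((A * V) $$ (p, k)) * (A * V) $$ (p, l)) = (if k = l then complex_of_real ((s k)\<^sup>2) else 0)"
  shows "(frobenius_norm n A)\<^sup>2 = (\<Sum>k<n. (s k)\<^sup>2)"
proof -
  have "(frobenius_norm n A)\<^sup>2 = (\<Sum>p<n. \<Sum>q<n. (cmod ((A * V) $$ (p, q)))\<^sup>2)"
    using frobenius_norm_mult_unitary[OF assms(1,2)] frobenius_norm_square[of n "A * V"] by simp
  also have "\<dots> = (\<Sum>q<n. \<Sum>p<n. (cmod ((A * V) $$ (p, q)))\<^sup>2)" by (rule sum.swap)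
  also have "\<dots> = (\<Sum>k<n. (s k)\<^sup>2)"
    by (intro sum.cong refl orthogonal_column_norm) (use assms(3) in auto)
  finally show ?thesis .
qed

context
  fixes A :: "complex mat" and s :: "nat \<Rightarrow> real" and n :: nat
  assumes sv: "singular_values A = image_mset s (mset_set {..<n})" and s0: "\<And>k. s k \<ge> 0"
begin

lemma schatten_1_eq: "schatten_norm 1 A = (\<Sum>k<n. s k)"
  unfolding schatten_norm_def sv using s0
  by (simp add: multiset.map_comp comp_def sum_unfold_sum_mset[symmetric] sum_nonneg)

lemma schatten_2_eq: "schatten_norm 2 A = sqrt (\<Sum>k<n. (s k)\<^sup>2)"
  unfolding schatten_norm_def sv using s0
  by (simp add: multiset.map_comp comp_def sum_unfold_sum_mset[symmetric] powr_half_sqrt sum_nonneg)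

lemma schatten_inf_eq: "schatten_inf_norm A = Max (insert 0 (s ` {..<n}))"
  unfolding schatten_inf_norm_def sv by simp

end

lemma schatten_2_eq_frobenius:
  assumes "A \<in> carrier_mat n n"
  shows "schatten_norm 2 A = frobenius_norm n A"
proof -
  obtain V s where svd: "is_svd n A V s"
    using singular_value_decomposition[OF assms] by blast
  note V = is_svdD[OF svd]
  then show ?thesis
    using schatten_2_eq[OF V(4,2)] frobenius_norm_eqI[OF frobenius_norm_eq_singular_values[OF assms V(1,3)]] by simp
qed

section \<open>Bessel's inequality, trace duality and comparison of the Schatten norms\<close>

lemma cmod_inner_le:
  "cmod (\<Sum>p\<in>S. cnj (a p) * b p) \<le> sqrt (\<Sum>p\<in>S. (cmod (a p))\<^sup>2) * sqrt (\<Sum>p\<in>S. (cmod (b p))\<^sup>2)"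
proof -
  have "cmod (\<Sum>p\<in>S. cnj (a p) * b p) \<le> (\<Sum>p\<in>S. \<bar>cmod (a p)\<bar> * \<bar>cmod (b p)\<bar>)"
    by (rule order_trans[OF norm_sum]) (simp add: norm_mult)
  also have "\<dots> \<le> L2_set (\<lambda>p. cmod (a p)) S * L2_set (\<lambda>p. cmod (b p)) S"
    by (rule L2_set_mult_ineq)
  finally show ?thesis unfolding L2_set_def .
qed

lemma unitary_col_norm:
  assumes "unitary_mat n X" "k < n"
  shows "(\<Sum>p<n. (cmod (X $$ (p, k)))\<^sup>2) = 1"
  using orthogonal_column_norm[of k n X "\<lambda>_. 1"] unitary_col_sum[OF assms(1)] assms(2) by simp

lemma unitary_row_norm:
  assumes "unitary_mat n X" "k < n"
  shows "(\<Sum>p<n. (cmod (X $$ (k, p)))\<^sup>2) = 1"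
proof -
  have "(\<Sum>p<n. (cmod (X $$ (k, p)))\<^sup>2) = (\<Sum>p<n. (cmod (mat_adjoint X $$ (p, k)))\<^sup>2)"
    using unitary_matD(1)[OF assms(1)] assms(2) by (intro sum.cong refl) simp
  then show ?thesis using unitary_col_norm[OF unitary_mat_adjoint[OF assms(1)] assms(2)] by simp
qed

lemma mult_unitary_change_basis:
  assumes "Z \<in> carrier_mat n n" "unitary_mat n V" "unitary_mat n V'" "p < n" "k < n"
  shows "(Z * V) $$ (p, k) = (\<Sum>j<n. (Z * V') $$ (p, j) * (mat_adjoint V' * V) $$ (j, k))"
proof -
  note V = unitary_matD[OF assms(2)] and V' = unitary_matD[OF assms(3)]
  have "Z * V = Z * (V' * mat_adjoint V') * V" unfolding V'(3) using assms(1) by simp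
  also have "\<dots> = (Z * V') * (mat_adjoint V' * V)"
    using assms(1) V(1) V'(1) by (simp add: assoc_mult_mat[of _ n n _ n _ n])
  finally show ?thesis
    using assms(1,4,5) V(1) V'(1) by (simp add: index_mult_mat_sum[of "Z * V'" n n _ n] del: index_mult_mat(1))
qed

text \<open>Expand the unit vector V e_k in the right singular basis V' of Z: the squared norm of
  its image is an average of the s_j^2 with weights |X_jk|^2 that sum to 1.\<close>

lemma column_norm_le_schatten_inf:
  assumes Z: "Z \<in> carrier_mat n n" and V: "unitary_mat n V" and k: "k < n"
  shows "(\<Sum>p<n. (cmod ((Z * V) $$ (p, k)))\<^sup>2) \<le> (schatten_inf_norm Z)\<^sup>2"
proof -
  obtain V' s where svd: "is_svd n Z V' s"
    using singular_value_decomposition[OF Z] by blast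
  note V' = is_svdD[OF svd]
  define X where "X = mat_adjoint V' * V"
  have X: "unitary_mat n X" unfolding X_def by (rule unitary_mat_mult[OF unitary_mat_adjoint[OF V'(1)] V])
  have "(\<Sum>p<n. (cmod ((Z * V) $$ (p, k)))\<^sup>2) = (\<Sum>p<n. (cmod (\<Sum>j<n. (Z * V') $$ (p, j) * X $$ (j, k)))\<^sup>2)"
    unfolding X_def using mult_unitary_change_basis[OF Z V V'(1) _ k] by simp
  also have "\<dots> = (\<Sum>j<n. (s j)\<^sup>2 * (cmod (X $$ (j, k)))\<^sup>2)"
    by (rule sum_norm_orthogonal) (use V'(3) in auto)
  also have "\<dots> \<le> (\<Sum>j<n. (schatten_inf_norm Z)\<^sup>2 * (cmod (X $$ (j, k)))\<^sup>2)"
  proof (intro sum_mono mult_right_mono power_mono)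
    fix j assume "j \<in> {..<n}"
    then show "s j \<le> schatten_inf_norm Z" unfolding schatten_inf_eq[OF V'(4,2)] by (intro Max_ge) auto
  qed (use V'(2) in auto)
  also have "\<dots> = (schatten_inf_norm Z)\<^sup>2"
    using unitary_col_norm[OF X k] by (simp add: sum_distrib_left[symmetric])
  finally show ?thesis .
qed

lemma bessel_inequality:
  fixes u :: "nat \<Rightarrow> nat \<Rightarrow> complex" and m n :: nat
  assumes orth: "\<And>k l. k < m \<Longrightarrow> l < m \<Longrightarrow>
      (\<Sum>p<n. cnj (u k p) * u l p) = (if k = l then complex_of_real (r k) else 0)"
    and r: "\<And>k. k < m \<Longrightarrow> r k \<le> 1"
  shows "(\<Sum>k<m. (cmod (\<Sum>p<n. cnj (u k p) * z p))\<^sup>2) \<le> (\<Sum>p<n. (cmod (z p))\<^sup>2)"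
proof -
  define c where "c k = (\<Sum>p<n. cnj (u k p) * z p)" for k
  define S where "S = (\<Sum>k<m. (cmod (c k))\<^sup>2)"
  define R where "R = (\<Sum>p<n. (cmod (z p))\<^sup>2)"
  have S0: "S \<ge> 0" and R0: "R \<ge> 0" unfolding S_def R_def by (simp_all add: sum_nonneg)
  define v where "v p = (\<Sum>k<m. u k p * c k)" for p
  have "(\<Sum>p<n. (cmod (v p))\<^sup>2) = (\<Sum>k<m. r k * (cmod (c k))\<^sup>2)"
    unfolding v_def by (rule sum_norm_orthogonal) (rule orth)
  also have "\<dots> \<le> (\<Sum>k<m. 1 * (cmod (c k))\<^sup>2)"
    by (intro sum_mono mult_right_mono) (use r in auto)
  also have "\<dots> = S" unfolding S_def by simp
  finally have v: "(\<Sum>p<n. (cmod (v p))\<^sup>2) \<le> S" .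
  have "complex_of_real S = (\<Sum>k<m. cnj (c k) * (\<Sum>p<n. cnj (u k p) * z p))"
    unfolding S_def of_real_sum cmod_square_eq c_def ..
  also have "\<dots> = (\<Sum>k<m. \<Sum>p<n. cnj (u k p * c k) * z p)"
    unfolding sum_distrib_left by (intro sum.cong refl) (simp add: mult_ac)
  also have "\<dots> = (\<Sum>p<n. \<Sum>k<m. cnj (u k p * c k) * z p)" by (rule sum.swap)
  also have "\<dots> = (\<Sum>p<n. cnj (v p) * z p)" unfolding v_def cnj_sum sum_distrib_right ..
  finally have "S = cmod (\<Sum>p<n. cnj (v p) * z p)" using S0 by (metis abs_of_nonneg norm_of_real)
  also have "\<dots> \<le> sqrt (\<Sum>p<n. (cmod (v p))\<^sup>2) * sqrt R" unfolding R_def by (rule cmod_inner_le)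
  also have "\<dots> \<le> sqrt S * sqrt R" using v R0 by (intro mult_right_mono) auto
  finally have "sqrt S * sqrt S \<le> sqrt S * sqrt R" using S0 by simp
  moreover have "sqrt S > 0" if "S \<noteq> 0" using S0 that by simp
  ultimately have "S \<le> R"
    using R0 mult_le_cancel_left_pos[of "sqrt S" "sqrt S" "sqrt R"] by (cases "S = 0") simp_all
  then show ?thesis unfolding S_def R_def c_def .
qed

text \<open>Trace duality in coordinates. Each V e_k is expanded in the right singular basis of Z;
  for a fixed singular index j, Cauchy-Schwarz over k pairs a unit row of X with Bessel coefficients
  of Z V' e_j, whose length is s_j.\<close>

lemma sum_inner_le_schatten_1:
  assumes Z: "Z \<in> carrier_mat n n" and V: "unitary_mat n V"
    and orth: "\<And>k l. k < n \<Longrightarrow> l < n \<Longrightarrow>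
      (\<Sum>p<n. cnj (u k p) * u l p) = (if k = l then complex_of_real (r k) else 0)"
    and r: "\<And>k. k < n \<Longrightarrow> r k \<le> 1"
  shows "(\<Sum>k<n. cmod (\<Sum>p<n. cnj (u k p) * (Z * V) $$ (p, k))) \<le> schatten_norm 1 Z"
proof -
  obtain V' s where svd: "is_svd n Z V' s"
    using singular_value_decomposition[OF Z] by blast
  note V' = is_svdD[OF svd]
  define X where "X = mat_adjoint V' * V"
  have X: "unitary_mat n X" unfolding X_def by (rule unitary_mat_mult[OF unitary_mat_adjoint[OF V'(1)] V])
  define c where "c k j = (\<Sum>p<n. cnj (u k p) * (Z * V') $$ (p, j))" for k j
  have "(\<Sum>k<n. cmod (\<Sum>p<n. cnj (u k p) * (Z * V) $$ (p, k))) \<le> (\<Sum>k<n. \<Sum>j<n. cmod (c k j) * cmod (X $$ (j, k)))"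
  proof (rule sum_mono)
    fix k assume "k \<in> {..<n}"
    then have k: "k < n" by simp
    have "(\<Sum>p<n. cnj (u k p) * (Z * V) $$ (p, k)) = (\<Sum>p<n. \<Sum>j<n. cnj (u k p) * (Z * V') $$ (p, j) * X $$ (j, k))"
      unfolding X_def using mult_unitary_change_basis[OF Z V V'(1) _ k]
      by (intro sum.cong refl) (simp add: sum_distrib_left mult.assoc)
    also have "\<dots> = (\<Sum>j<n. \<Sum>p<n. cnj (u k p) * (Z * V') $$ (p, j) * X $$ (j, k))" by (rule sum.swap)
    also have "\<dots> = (\<Sum>j<n. c k j * X $$ (j, k))" unfolding c_def sum_distrib_right ..
    finally show "cmod (\<Sum>p<n. cnj (u k p) * (Z * V) $$ (p, k)) \<le> (\<Sum>j<n. cmod (c k j) * cmod (X $$ (j, k)))"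
      by (simp only: norm_mult[symmetric] norm_sum)
  qed
  also have "\<dots> = (\<Sum>j<n. \<Sum>k<n. cmod (c k j) * cmod (X $$ (j, k)))" by (rule sum.swap)
  also have "\<dots> \<le> (\<Sum>j<n. s j)"
  proof (rule sum_mono)
    fix j assume "j \<in> {..<n}"
    then have j: "j < n" by simp
    have "(\<Sum>k<n. cmod (c k j) * cmod (X $$ (j, k))) \<le> L2_set (\<lambda>k. cmod (c k j)) {..<n} * L2_set (\<lambda>k. cmod (X $$ (j, k))) {..<n}"
      using L2_set_mult_ineq[of "\<lambda>k. cmod (c k j)" "\<lambda>k. cmod (X $$ (j, k))" "{..<n}"] by simp
    also have "L2_set (\<lambda>k. cmod (X $$ (j, k))) {..<n} = 1"
      unfolding L2_set_def unitary_row_norm[OF X j] by simp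
    also have "L2_set (\<lambda>k. cmod (c k j)) {..<n} \<le> sqrt (\<Sum>p<n. (cmod ((Z * V') $$ (p, j)))\<^sup>2)"
      unfolding L2_set_def c_def by (intro real_sqrt_le_mono bessel_inequality[where r = r] orth r)
    also have "(\<Sum>p<n. (cmod ((Z * V') $$ (p, j)))\<^sup>2) = (s j)\<^sup>2"
      by (rule orthogonal_column_norm[OF j V'(3)])
    also have "sqrt ((s j)\<^sup>2) = s j" using V'(2) by simp
    finally show "(\<Sum>k<n. cmod (c k j) * cmod (X $$ (j, k))) \<le> s j" by simp
  qed
  also have "\<dots> = schatten_norm 1 Z" using schatten_1_eq[OF V'(4,2)] by simp
  finally show ?thesis .
qed

text \<open>Equivalence of the norms in finite dimension. The factor n is harmless: it serves only
  to see that the suprema in the induced norms are finite and that the norms vanish only at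
  0.\<close>

lemma schatten_norm_comparison:
  assumes "A \<in> carrier_mat n n"
  shows "0 \<le> schatten_inf_norm A" "schatten_inf_norm A \<le> frobenius_norm n A"
    "frobenius_norm n A \<le> schatten_norm 1 A" "schatten_norm 1 A \<le> n * schatten_inf_norm A"
proof -
  obtain V s where svd: "is_svd n A V s"
    using singular_value_decomposition[OF assms] by blast
  note V = is_svdD[OF svd]
  have F: "frobenius_norm n A = L2_set s {..<n}"
    unfolding schatten_2_eq_frobenius[OF assms, symmetric] schatten_2_eq[OF V(4,2)] L2_set_def ..
  note I = schatten_inf_eq[OF V(4,2)]
  show "0 \<le> schatten_inf_norm A" unfolding I by simp
  show "schatten_inf_norm A \<le> frobenius_norm n A"
    unfolding I F by (auto intro: member_le_L2_set)
  show "frobenius_norm n A \<le> schatten_norm 1 A"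
    unfolding F schatten_1_eq[OF V(4,2)] by (rule L2_set_le_sum) (use V(2) in auto)
  have "s k \<le> schatten_inf_norm A" if "k < n" for k unfolding I using that by simp
  then have "(\<Sum>k<n. s k) \<le> (\<Sum>k<n. schatten_inf_norm A)" by (intro sum_mono) auto
  then show "schatten_norm 1 A \<le> n * schatten_inf_norm A" unfolding schatten_1_eq[OF V(4,2)] by simp
qed

section \<open>Norms of diagonal matrices in a unitary basis\<close>

lemma singular_values_diagonal_in:
  assumes "unitary_mat n W"
  shows "singular_values (diagonal_in n W a) = image_mset (\<lambda>i. cmod (a i)) (mset_set {..<n})"
proof -
  have "mat_adjoint (diagonal_in n W a) * diagonal_in n W a = diagonal_in n W (\<lambda>i. complex_of_real ((cmod (a i))\<^sup>2))"
    unfolding diagonal_in_adjoint[OF unitary_matD(1)[OF assms]] diagonal_in_mult[OF assms] cmod_square_eq ..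
  from singular_values_eq[OF assms this] show ?thesis by simp
qed

lemma frobenius_norm_diagonal_in:
  assumes "unitary_mat n W"
  shows "frobenius_norm n (diagonal_in n W a) = sqrt (\<Sum>i<n. (cmod (a i))\<^sup>2)"
  using schatten_2_eq[OF singular_values_diagonal_in[OF assms]]
    schatten_2_eq_frobenius[OF diagonal_in_carrier[OF unitary_matD(1)[OF assms]]] by simp

lemma schatten_1_diagonal_in:
  "unitary_mat n W \<Longrightarrow> schatten_norm 1 (diagonal_in n W a) = (\<Sum>i<n. cmod (a i))"
  by (rule schatten_1_eq[OF singular_values_diagonal_in]) auto

lemma schatten_inf_diagonal_in_le:
  assumes "unitary_mat n W" "c \<ge> 0" "\<And>i. i < n \<Longrightarrow> cmod (a i) \<le> c"
  shows "schatten_inf_norm (diagonal_in n W a) \<le> c"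
  unfolding schatten_inf_eq[OF singular_values_diagonal_in[OF assms(1)] norm_ge_zero]
  using assms by simp

lemma frobenius_norm_triangle:
  assumes "A \<in> carrier_mat n n" "B \<in> carrier_mat n n"
  shows "frobenius_norm n (A + B) \<le> frobenius_norm n A + frobenius_norm n B"
proof -
  let ?S = "{..<n} \<times> {..<n}"
  have "frobenius_norm n (A + B) \<le> L2_set (\<lambda>x. cmod (A $$ x) + cmod (B $$ x)) ?S"
    unfolding frobenius_norm_def case_prod_unfold prod.collapse
    by (rule L2_set_mono) (use assms in \<open>auto simp: norm_triangle_ineq\<close>)
  also have "\<dots> \<le> L2_set (\<lambda>x. cmod (A $$ x)) ?S + L2_set (\<lambda>x. cmod (B $$ x)) ?S"
    by (rule L2_set_triangle_ineq)
  finally show ?thesis unfolding frobenius_norm_def case_prod_unfold prod.collapse .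
qed

lemma frobenius_norm_smult:
  assumes "A \<in> carrier_mat n n"
  shows "frobenius_norm n (c \<cdot>\<^sub>m A) = cmod c * frobenius_norm n A"
proof -
  have "frobenius_norm n (c \<cdot>\<^sub>m A) = L2_set (\<lambda>x. cmod c * cmod (A $$ x)) ({..<n} \<times> {..<n})"
    unfolding frobenius_norm_def case_prod_unfold prod.collapse
    by (rule L2_set_cong[OF refl]) (use assms in \<open>auto simp: norm_mult\<close>)
  then show ?thesis unfolding frobenius_norm_def case_prod_unfold prod.collapse
    by (simp add: L2_set_right_distrib)
qed

lemma frobenius_norm_eq_0_iff:
  assumes "A \<in> carrier_mat n n"
  shows "frobenius_norm n A = 0 \<longleftrightarrow> A = 0\<^sub>m n n"
proof -
  have "frobenius_norm n A = 0 \<longleftrightarrow> (\<forall>p<n. \<forall>q<n. A $$ (p, q) = 0)"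
    unfolding frobenius_norm_def by (subst L2_set_eq_0_iff) auto
  also have "\<dots> \<longleftrightarrow> A = 0\<^sub>m n n" using assms by (auto intro!: eq_matI)
  finally show ?thesis .
qed

section \<open>Linear maps on matrices\<close>

lemma diagonal_in_add:
  assumes "W \<in> carrier_mat n n"
  shows "diagonal_in n W a + diagonal_in n W b = diagonal_in n W (\<lambda>i. a i + b i)"
  by (rule eq_matI) (use assms in \<open>auto simp: diagonal_in_index sum.distrib distrib_right\<close>)

lemma diagonal_in_smult:
  assumes "W \<in> carrier_mat n n"
  shows "c \<cdot>\<^sub>m diagonal_in n W a = diagonal_in n W (\<lambda>i. c * a i)"
  by (rule eq_matI) (use assms in \<open>auto simp: diagonal_in_index sum_distrib_left mult.assoc\<close>)

text \<open>Resolution into the rank-one spectral projections, written entrywise so that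
  \<open>linear_sum\<close> can carry T through the sum.\<close>

lemma diagonal_in_eq_sum:
  assumes "W \<in> carrier_mat n n"
  shows "diagonal_in n W a =
    mat n n (\<lambda>(p, q). \<Sum>i<n. a i * diagonal_in n W (\<lambda>j. if j = i then 1 else 0) $$ (p, q))"
proof (rule eq_matI)
  fix p q assume "p < dim_row (mat n n (\<lambda>(p, q). \<Sum>i<n. a i * diagonal_in n W (\<lambda>j. if j = i then 1 else 0) $$ (p, q)))"
    "q < dim_col (mat n n (\<lambda>(p, q). \<Sum>i<n. a i * diagonal_in n W (\<lambda>j. if j = i then 1 else 0) $$ (p, q)))"
  then have pq: "p < n" "q < n" by auto
  have "diagonal_in n W (\<lambda>j. if j = i then 1 else 0) $$ (p, q) = W $$ (p, i) * cnj (W $$ (q, i))" if "i < n" for i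
  proof -
    have "diagonal_in n W (\<lambda>j. if j = i then 1 else 0) $$ (p, q)
        = (\<Sum>j<n. if j = i then W $$ (p, i) * cnj (W $$ (q, i)) else 0)"
      unfolding diagonal_in_index[OF assms pq] by (intro sum.cong refl) simp
    then show ?thesis using that by simp
  qed
  then show "diagonal_in n W a $$ (p, q) =
      mat n n (\<lambda>(p, q). \<Sum>i<n. a i * diagonal_in n W (\<lambda>j. if j = i then 1 else 0) $$ (p, q)) $$ (p, q)"
    using pq by (simp add: diagonal_in_index[OF assms pq])
qed (use assms in auto)

lemma orth_projection_diagonal_in:
  assumes "unitary_mat n W"
  shows "orth_projection n (diagonal_in n W (\<lambda>i. if i \<in> I then 1 else 0))"
proof -
  let ?a = "\<lambda>i. if i \<in> I then 1 else 0 :: complex"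
  have "(\<lambda>i. ?a i * ?a i) = ?a" "(\<lambda>i. cnj (?a i)) = ?a" by auto
  then show ?thesis
    using diagonal_in_mult[OF assms, of ?a ?a] diagonal_in_adjoint[OF unitary_matD(1)[OF assms], of ?a]
      diagonal_in_carrier[OF unitary_matD(1)[OF assms], of ?a]
    unfolding orth_projection_def by simp
qed

section \<open>Boundedness of linear maps and the induced norms\<close>

context
  fixes N :: nat and T :: "complex mat \<Rightarrow> complex mat"
  assumes lin: "linear_on_mats N T"
begin

lemma linear_carrier [simp]: "X \<in> carrier_mat N N \<Longrightarrow> T X \<in> carrier_mat N N"
  using lin unfolding linear_on_mats_def by blast

lemma linear_dim [simp]:
  assumes "X \<in> carrier_mat N N"
  shows "dim_row (T X) = N" "dim_col (T X) = N"
  using carrier_matD[OF linear_carrier[OF assms]] by auto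

lemma linear_add: "X \<in> carrier_mat N N \<Longrightarrow> Y \<in> carrier_mat N N \<Longrightarrow> T (X + Y) = T X + T Y"
  using lin unfolding linear_on_mats_def by blast

lemma linear_smult: "X \<in> carrier_mat N N \<Longrightarrow> T (c \<cdot>\<^sub>m X) = c \<cdot>\<^sub>m T X"
  using lin unfolding linear_on_mats_def by blast

lemma linear_zero: "T (0\<^sub>m N N) = 0\<^sub>m N N"
proof -
  have "T (0 \<cdot>\<^sub>m 0\<^sub>m N N) = 0 \<cdot>\<^sub>m T (0\<^sub>m N N)" by (rule linear_smult) simp
  moreover have "0 \<cdot>\<^sub>m 0\<^sub>m N N = (0\<^sub>m N N :: complex mat)" by (rule eq_matI) auto
  moreover have "0 \<cdot>\<^sub>m T (0\<^sub>m N N) = 0\<^sub>m N N"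
    by (intro eq_matI) auto
  ultimately show ?thesis by simp
qed

lemma linear_sum:
  assumes "finite S" "\<And>i. i \<in> S \<Longrightarrow> f i \<in> carrier_mat N N"
  shows "T (mat N N (\<lambda>x. \<Sum>i\<in>S. c i * f i $$ x)) = mat N N (\<lambda>x. \<Sum>i\<in>S. c i * T (f i) $$ x)
    \<and> frobenius_norm N (T (mat N N (\<lambda>x. \<Sum>i\<in>S. c i * f i $$ x))) \<le> (\<Sum>i\<in>S. cmod (c i) * frobenius_norm N (T (f i)))"
  using assms
proof (induction S rule: finite_induct)
  case empty
  have "mat N N (\<lambda>x. 0) = (0\<^sub>m N N :: complex mat)" by (rule eq_matI) auto
  then show ?case using linear_zero frobenius_norm_eq_0_iff[of "0\<^sub>m N N" N] by simp
next
  case (insert j S)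
  let ?X = "mat N N (\<lambda>x. \<Sum>i\<in>S. c i * f i $$ x)"
  have fj: "f j \<in> carrier_mat N N" using insert.prems by simp
  then have Tfj: "T (f j) \<in> carrier_mat N N" by simp
  have "mat N N (\<lambda>x. \<Sum>i\<in>insert j S. c i * f i $$ x) = c j \<cdot>\<^sub>m f j + ?X"
    by (rule eq_matI) (use fj insert.hyps in auto)
  then have eq: "T (mat N N (\<lambda>x. \<Sum>i\<in>insert j S. c i * f i $$ x)) = c j \<cdot>\<^sub>m T (f j) + T ?X"
    using fj by (simp add: linear_add linear_smult)
  have IH: "T ?X = mat N N (\<lambda>x. \<Sum>i\<in>S. c i * T (f i) $$ x)"
      "frobenius_norm N (T ?X) \<le> (\<Sum>i\<in>S. cmod (c i) * frobenius_norm N (T (f i)))"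
    using insert.IH insert.prems by auto
  have "T (mat N N (\<lambda>x. \<Sum>i\<in>insert j S. c i * f i $$ x)) = mat N N (\<lambda>x. \<Sum>i\<in>insert j S. c i * T (f i) $$ x)"
    unfolding eq IH(1) by (rule eq_matI) (use Tfj insert.hyps in auto)
  moreover have "frobenius_norm N (c j \<cdot>\<^sub>m T (f j) + T ?X) \<le> cmod (c j) * frobenius_norm N (T (f j)) + frobenius_norm N (T ?X)"
    using frobenius_norm_triangle[of "c j \<cdot>\<^sub>m T (f j)" N "T ?X"] Tfj by (simp add: frobenius_norm_smult)
  ultimately show ?case using eq IH(2) insert.hyps by simp
qed

text \<open>Expand X in matrix units; each coefficient is an entry of X and so at most the Frobenius
  norm. Some finite C is needed before the suprema of the induced norms can be used.\<close>

lemma frobenius_bounded: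
  obtains C where "C \<ge> 0" "\<And>X. X \<in> carrier_mat N N \<Longrightarrow> frobenius_norm N (T X) \<le> C * frobenius_norm N X"
proof -
  define f where "f y = mat N N (\<lambda>x. if x = y then 1 else 0 :: complex)" for y
  let ?S = "{..<N} \<times> {..<N}"
  define C where "C = (\<Sum>y\<in>?S. frobenius_norm N (T (f y)))"
  have "frobenius_norm N (T X) \<le> C * frobenius_norm N X" if X: "X \<in> carrier_mat N N" for X
  proof -
    have "(\<Sum>y\<in>?S. X $$ y * f y $$ x) = X $$ x" if "x \<in> ?S" for x
    proof -
      have "(\<Sum>y\<in>?S. X $$ y * f y $$ x) = (\<Sum>y\<in>?S. if y = x then X $$ x else 0)"
      proof (rule sum.cong[OF refl])
        fix y
        have "f y $$ x = (if x = y then 1 else 0)" using that by (cases x) (simp add: f_def)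
        then show "X $$ y * f y $$ x = (if y = x then X $$ x else 0)" by simp
      qed
      then show ?thesis using that by simp
    qed
    then have "X = mat N N (\<lambda>x. \<Sum>y\<in>?S. X $$ y * f y $$ x)"
      by (intro eq_matI) (use X in auto)
    moreover have "frobenius_norm N (T (mat N N (\<lambda>x. \<Sum>y\<in>?S. X $$ y * f y $$ x))) \<le>
        (\<Sum>y\<in>?S. cmod (X $$ y) * frobenius_norm N (T (f y)))"
      by (rule linear_sum[THEN conjunct2]) (auto simp: f_def)
    ultimately have "frobenius_norm N (T X) \<le> (\<Sum>y\<in>?S. cmod (X $$ y) * frobenius_norm N (T (f y)))" by simp
    also have "\<dots> \<le> (\<Sum>y\<in>?S. frobenius_norm N X * frobenius_norm N (T (f y)))"
    proof (intro sum_mono mult_right_mono)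
      fix y assume "y \<in> ?S"
      then show "cmod (X $$ y) \<le> frobenius_norm N X"
        unfolding frobenius_norm_def using member_le_L2_set[of ?S y "\<lambda>(p, q). cmod (X $$ (p, q))"] by auto
    qed simp
    also have "\<dots> = C * frobenius_norm N X" unfolding C_def by (simp add: sum_distrib_left mult.commute)
    finally show ?thesis .
  qed
  moreover have "C \<ge> 0" unfolding C_def by (simp add: sum_nonneg)
  ultimately show ?thesis using that by blast
qed

text \<open>An a priori constant C makes the set of quotients bounded above; only then is
  \<open>Sup\<close> known to be an upper bound.\<close>

lemma induced_norm_bound:
  assumes "\<And>X. X \<in> carrier_mat N N \<Longrightarrow> nrm (T X) \<le> C * nrm X"
    and "\<And>X. X \<in> carrier_mat N N \<Longrightarrow> X \<noteq> 0\<^sub>m N N \<Longrightarrow> nrm X > 0"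
    and "X \<in> carrier_mat N N" "X \<noteq> 0\<^sub>m N N"
  shows "nrm (T X) \<le> induced_norm N nrm T * nrm X"
proof -
  have "nrm (T X) / nrm X \<le> induced_norm N nrm T"
    unfolding induced_norm_def
  proof (rule cSup_upper)
    show "bdd_above {nrm (T X) / nrm X |X. X \<in> carrier_mat N N \<and> X \<noteq> 0\<^sub>m N N}"
      by (rule bdd_aboveI[of _ C]) (use assms(1,2) in \<open>auto simp: pos_divide_le_eq\<close>)
  qed (use assms in blast)
  then show ?thesis using assms(2)[OF assms(3,4)] by (simp add: pos_divide_le_eq)
qed

lemma frobenius_pos: "X \<in> carrier_mat N N \<Longrightarrow> X \<noteq> 0\<^sub>m N N \<Longrightarrow> frobenius_norm N X > 0"
  using frobenius_norm_eq_0_iff[of X N] frobenius_norm_nonneg[of N X] by linarith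

lemma induced_2_bound:
  assumes "X \<in> carrier_mat N N" "X \<noteq> 0\<^sub>m N N"
  shows "frobenius_norm N (T X) \<le> induced_norm N (schatten_norm 2) T * frobenius_norm N X"
proof -
  obtain C where C: "\<And>X. X \<in> carrier_mat N N \<Longrightarrow> frobenius_norm N (T X) \<le> C * frobenius_norm N X"
    using frobenius_bounded by blast
  have "schatten_norm 2 (T X) \<le> induced_norm N (schatten_norm 2) T * schatten_norm 2 X"
    by (rule induced_norm_bound[where C = C])
      (use assms C frobenius_pos in \<open>auto simp: schatten_2_eq_frobenius[of _ N]\<close>)
  then show ?thesis using assms by (simp add: schatten_2_eq_frobenius[of _ N])
qed

lemma induced_1_bound:
  assumes "X \<in> carrier_mat N N" "X \<noteq> 0\<^sub>m N N"
  shows "schatten_norm 1 (T X) \<le> induced_norm N (schatten_norm 1) T * schatten_norm 1 X"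
proof -
  obtain C where C: "C \<ge> 0" "\<And>X. X \<in> carrier_mat N N \<Longrightarrow> frobenius_norm N (T X) \<le> C * frobenius_norm N X"
    using frobenius_bounded by blast
  have "schatten_norm 1 (T Y) \<le> (N * C) * schatten_norm 1 Y" if Y: "Y \<in> carrier_mat N N" for Y
  proof -
    have "schatten_norm 1 (T Y) \<le> N * schatten_inf_norm (T Y)"
      using schatten_norm_comparison(4)[of "T Y" N] Y by simp
    also have "\<dots> \<le> N * (C * frobenius_norm N Y)"
      using schatten_norm_comparison(2)[of "T Y" N] Y C(2)[OF Y] by (intro mult_left_mono) auto
    also have "\<dots> \<le> N * (C * schatten_norm 1 Y)"
      using schatten_norm_comparison(3)[OF Y] C(1) by (intro mult_left_mono) auto
    finally show ?thesis by simp
  qed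
  moreover have "schatten_norm 1 Y > 0" if "Y \<in> carrier_mat N N" "Y \<noteq> 0\<^sub>m N N" for Y
    using schatten_norm_comparison(3)[OF that(1)] frobenius_pos[OF that] by linarith
  ultimately show ?thesis using induced_norm_bound assms by blast
qed

lemma induced_inf_bound:
  assumes "X \<in> carrier_mat N N" "X \<noteq> 0\<^sub>m N N"
  shows "schatten_inf_norm (T X) \<le> induced_norm N schatten_inf_norm T * schatten_inf_norm X"
proof -
  obtain C where C: "C \<ge> 0" "\<And>X. X \<in> carrier_mat N N \<Longrightarrow> frobenius_norm N (T X) \<le> C * frobenius_norm N X"
    using frobenius_bounded by blast
  have fro_inf: "frobenius_norm N Y \<le> N * schatten_inf_norm Y" if "Y \<in> carrier_mat N N" for Y
    using schatten_norm_comparison(3,4)[OF that] by linarith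
  have "schatten_inf_norm (T Y) \<le> (C * N) * schatten_inf_norm Y" if Y: "Y \<in> carrier_mat N N" for Y
  proof -
    have "schatten_inf_norm (T Y) \<le> C * frobenius_norm N Y"
      using schatten_norm_comparison(2)[of "T Y" N] Y C(2)[OF Y] by simp
    also have "\<dots> \<le> C * (N * schatten_inf_norm Y)"
      using fro_inf[OF Y] C(1) by (intro mult_left_mono) auto
    finally show ?thesis by simp
  qed
  moreover have "schatten_inf_norm Y > 0" if "Y \<in> carrier_mat N N" "Y \<noteq> 0\<^sub>m N N" for Y
    using fro_inf[OF that(1)] frobenius_pos[OF that] schatten_norm_comparison(1)[OF that(1)]
    by (cases "schatten_inf_norm Y = 0") auto
  ultimately show ?thesis using induced_norm_bound assms by blast
qed

section \<open>Reduction from arbitrary to positive matrices\<close>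

lemma hermitian_bound_from_positive:
  assumes pos: "\<And>W a. unitary_mat N W \<Longrightarrow> (\<And>i. a i \<ge> 0) \<Longrightarrow>
      frobenius_norm N (T (diagonal_in N W (\<lambda>i. complex_of_real (a i))))
        \<le> y * frobenius_norm N (diagonal_in N W (\<lambda>i. complex_of_real (a i)))"
    and y: "y \<ge> 0" and H: "H \<in> carrier_mat N N" "mat_adjoint H = H"
  shows "frobenius_norm N (T H) \<le> y * (sqrt 2 * frobenius_norm N H)"
proof -
  obtain W d where W: "unitary_mat N W" and Hd: "H = diagonal_in N W (\<lambda>i. complex_of_real (d i))"
    using hermitian_diagonalization[OF H] by blast
  note Wc = unitary_matD(1)[OF W]
  define A where "A = diagonal_in N W (\<lambda>i. complex_of_real (max (d i) 0))"
  define B where "B = diagonal_in N W (\<lambda>i. complex_of_real (max (- d i) 0))"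
  have AB: "A \<in> carrier_mat N N" "B \<in> carrier_mat N N" unfolding A_def B_def using Wc by auto
  have "H = A + (- 1) \<cdot>\<^sub>m B"
    unfolding A_def B_def diagonal_in_smult[OF Wc] diagonal_in_add[OF Wc] Hd
    by (rule arg_cong[where f = "diagonal_in N W"]) (auto simp: fun_eq_iff max_def)
  then have "T H = T A + (- 1) \<cdot>\<^sub>m T B" using AB by (simp add: linear_add linear_smult)
  then have "frobenius_norm N (T H) \<le> frobenius_norm N (T A) + frobenius_norm N (T B)"
    using frobenius_norm_triangle[of "T A" N "(- 1) \<cdot>\<^sub>m T B"] AB by (simp add: frobenius_norm_smult)
  also have "\<dots> \<le> y * frobenius_norm N A + y * frobenius_norm N B"
    unfolding A_def B_def by (intro add_mono pos W) auto
  also have "\<dots> = y * (frobenius_norm N A + frobenius_norm N B)" by (simp add: distrib_left)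
  also have "\<dots> \<le> y * (sqrt 2 * frobenius_norm N H)"
  proof (rule mult_left_mono[OF _ y])
    \<comment> \<open>Positive and negative parts have disjoint spectral supports and are
      orthogonal, so passing from the sum of two norms to one norm costs only sqrt 2.\<close>
    have "(frobenius_norm N A)\<^sup>2 + (frobenius_norm N B)\<^sup>2 = (frobenius_norm N H)\<^sup>2"
      unfolding A_def B_def Hd frobenius_norm_diagonal_in[OF W]
      unfolding real_sqrt_pow2[OF sum_nonneg[OF zero_le_power2]] sum.distrib[symmetric]
      by (intro sum.cong refl) (auto simp: max_def)
    moreover have "(frobenius_norm N A + frobenius_norm N B)\<^sup>2 \<le> 2 * ((frobenius_norm N A)\<^sup>2 + (frobenius_norm N B)\<^sup>2)"
      using sum_squares_bound[of "frobenius_norm N A" "frobenius_norm N B"] by (simp add: power2_sum)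
    ultimately have "(frobenius_norm N A + frobenius_norm N B)\<^sup>2 \<le> (sqrt 2 * frobenius_norm N H)\<^sup>2"
      by (simp add: power_mult_distrib)
    then show "frobenius_norm N A + frobenius_norm N B \<le> sqrt 2 * frobenius_norm N H"
      by (rule power2_le_imp_le) simp
  qed
  finally show ?thesis .
qed

text \<open>The Cartesian decomposition X = A + i B into Hermitian A and B satisfies ||A||^2 +
  ||B||^2 = ||X||^2, which costs a second sqrt 2 on top of the one for Hermitian matrices.\<close>

lemma bound_from_positive:
  assumes pos: "\<And>W a. unitary_mat N W \<Longrightarrow> (\<And>i. a i \<ge> 0) \<Longrightarrow>
      frobenius_norm N (T (diagonal_in N W (\<lambda>i. complex_of_real (a i))))
        \<le> y * frobenius_norm N (diagonal_in N W (\<lambda>i. complex_of_real (a i)))"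
    and y: "y \<ge> 0" and X: "X \<in> carrier_mat N N"
  shows "frobenius_norm N (T X) \<le> 2 * y * frobenius_norm N X"
proof -
  define A where "A = (1 / 2) \<cdot>\<^sub>m (X + mat_adjoint X)"
  define B where "B = (- \<i> / 2) \<cdot>\<^sub>m (X + (- 1) \<cdot>\<^sub>m mat_adjoint X)"
  have AB: "A \<in> carrier_mat N N" "B \<in> carrier_mat N N" unfolding A_def B_def using X by auto
  have Aix: "A $$ (p, q) = (X $$ (p, q) + cnj (X $$ (q, p))) / 2" if "p < N" "q < N" for p q
    unfolding A_def using X that by simp
  have Bix: "B $$ (p, q) = - \<i> * (X $$ (p, q) - cnj (X $$ (q, p))) / 2" if "p < N" "q < N" for p q
    unfolding B_def using X that by simp
  have HA: "mat_adjoint A = A"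
    by (rule eq_matI) (use AB in \<open>auto simp: Aix\<close>)
  have HB: "mat_adjoint B = B"
    by (rule eq_matI) (use AB in \<open>auto simp: Bix algebra_simps\<close>)
  have "X = A + \<i> \<cdot>\<^sub>m B"
    by (rule eq_matI) (use AB X in \<open>auto simp: Aix Bix field_simps\<close>)
  then have "T X = T A + \<i> \<cdot>\<^sub>m T B" using AB by (simp add: linear_add linear_smult)
  then have "frobenius_norm N (T X) \<le> frobenius_norm N (T A) + frobenius_norm N (T B)"
    using frobenius_norm_triangle[of "T A" N "\<i> \<cdot>\<^sub>m T B"] AB by (simp add: frobenius_norm_smult)
  also have "\<dots> \<le> y * (sqrt 2 * frobenius_norm N A) + y * (sqrt 2 * frobenius_norm N B)"
    by (intro add_mono hermitian_bound_from_positive[OF pos y]) (use AB HA HB in auto)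
  also have "\<dots> = y * (sqrt 2 * (frobenius_norm N A + frobenius_norm N B))" by (simp add: algebra_simps)
  also have "\<dots> \<le> y * (2 * frobenius_norm N X)"
  proof (rule mult_left_mono[OF _ y])
    have "(frobenius_norm N A)\<^sup>2 + (frobenius_norm N B)\<^sup>2 =
       (\<Sum>p<N. \<Sum>q<N. (cmod (X $$ (p, q)))\<^sup>2 / 2 + (cmod (X $$ (q, p)))\<^sup>2 / 2)"
    proof -
      have "(cmod (A $$ (p, q)))\<^sup>2 + (cmod (B $$ (p, q)))\<^sup>2 = (cmod (X $$ (p, q)))\<^sup>2 / 2 + (cmod (X $$ (q, p)))\<^sup>2 / 2"
        if "p < N" "q < N" for p q
        unfolding Aix[OF that] Bix[OF that] cmod_power2
        by (simp add: power2_eq_square field_simps)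
      then show ?thesis unfolding frobenius_norm_square sum.distrib[symmetric] by (intro sum.cong refl) auto
    qed
    also have "\<dots> = (\<Sum>p<N. \<Sum>q<N. (cmod (X $$ (p, q)))\<^sup>2 / 2) + (\<Sum>p<N. \<Sum>q<N. (cmod (X $$ (q, p)))\<^sup>2 / 2)"
      by (simp add: sum.distrib)
    also have "(\<Sum>p<N. \<Sum>q<N. (cmod (X $$ (q, p)))\<^sup>2 / 2) = (\<Sum>q<N. \<Sum>p<N. (cmod (X $$ (q, p)))\<^sup>2 / 2)"
      by (rule sum.swap)
    also have "(\<Sum>p<N. \<Sum>q<N. (cmod (X $$ (p, q)))\<^sup>2 / 2) + (\<Sum>q<N. \<Sum>p<N. (cmod (X $$ (q, p)))\<^sup>2 / 2)
        = (frobenius_norm N X)\<^sup>2"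
      unfolding frobenius_norm_square by (simp add: sum_divide_distrib[symmetric])
    finally have sq: "(frobenius_norm N A)\<^sup>2 + (frobenius_norm N B)\<^sup>2 = (frobenius_norm N X)\<^sup>2" .
    have "(frobenius_norm N A + frobenius_norm N B)\<^sup>2 \<le> 2 * ((frobenius_norm N A)\<^sup>2 + (frobenius_norm N B)\<^sup>2)"
      using sum_squares_bound[of "frobenius_norm N A" "frobenius_norm N B"] by (simp add: power2_sum)
    then have "(sqrt 2 * (frobenius_norm N A + frobenius_norm N B))\<^sup>2 \<le> (2 * frobenius_norm N X)\<^sup>2"
      unfolding sq by (simp add: power_mult_distrib)
    then show "sqrt 2 * (frobenius_norm N A + frobenius_norm N B) \<le> 2 * frobenius_norm N X"
      by (rule power2_le_imp_le) simp
  qed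
  finally show ?thesis by simp
qed

end

section \<open>The main estimate\<close>

text \<open>Reduces to \<open>bilinear_form_bound\<close> with entries t_ki = <u_k, T(E_i) v_k>
  built from the singular vectors of T(X): the form then recovers \<eta>, the operator norm bound
  controls rows and the trace norm bound controls columns.\<close>

lemma positive_matrix_estimate:
  assumes lin: "linear_on_mats N T" and W: "unitary_mat N W"
    and x0: "\<And>i. x i \<ge> 0" and x1: "(\<Sum>i<N. (x i)\<^sup>2) = 1"
    and K: "K \<ge> 0" "\<And>I. I \<subseteq> {..<N} \<Longrightarrow>
      frobenius_norm N (T (diagonal_in N W (\<lambda>i. if i \<in> I then 1 else 0))) \<le> K * sqrt (card I)"
    and \<alpha>: "\<alpha> > 0" "\<And>X. X \<in> carrier_mat N N \<Longrightarrow> schatten_norm 1 (T X) \<le> \<alpha> * schatten_norm 1 X"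
    and \<beta>: "\<beta> > 0" "\<And>X. X \<in> carrier_mat N N \<Longrightarrow> schatten_inf_norm (T X) \<le> \<beta> * schatten_inf_norm X"
    and \<eta>: "\<eta> = frobenius_norm N (T (diagonal_in N W (\<lambda>i. complex_of_real (x i))))" "\<eta> > 0"
  shows "\<eta>\<^sup>2 \<le> \<alpha> * \<beta>" "\<eta> \<le> 3 * K * sqrt (1 + ln (16 * \<alpha> * \<beta> / \<eta>\<^sup>2))"
proof -
  note Wc = unitary_matD(1)[OF W]
  define D where "D = diagonal_in N W"
  have D: "D a \<in> carrier_mat N N" for a unfolding D_def using Wc by simp
  have TD: "T (D a) \<in> carrier_mat N N" for a by (rule linear_carrier[OF lin D])
  define E where "E i = D (\<lambda>j. if j = i then 1 else 0)" for i
  have E: "E i \<in> carrier_mat N N" for i unfolding E_def by (rule D)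
  have TE: "T (E i) \<in> carrier_mat N N" for i by (rule linear_carrier[OF lin E])
  have TD_sum: "T (D a) = mat N N (\<lambda>z. \<Sum>i<N. a i * T (E i) $$ z)" for a
  proof -
    have "D a = mat N N (\<lambda>z. \<Sum>i<N. a i * E i $$ z)"
      using diagonal_in_eq_sum[OF Wc, of a] unfolding D_def E_def by (simp add: case_prod_unfold)
    then show ?thesis using linear_sum[OF lin, of "{..<N}" E a] E by simp
  qed

  define Y where "Y = T (D (\<lambda>i. complex_of_real (x i)))"
  have Y: "Y \<in> carrier_mat N N" unfolding Y_def by (rule TD)
  obtain V s where svd: "is_svd N Y V s"
    using singular_value_decomposition[OF Y] by blast
  note V = is_svdD(1)[OF svd] and s0 = is_svdD(2)[OF svd] and orth = is_svdD(3)[OF svd]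
  note Vc = unitary_matD(1)[OF V]
  have ss: "(\<Sum>k<N. (s k)\<^sup>2) = \<eta>\<^sup>2"
    using frobenius_norm_eq_singular_values[OF Y V orth] \<eta>(1) unfolding Y_def D_def by simp
  \<comment> \<open>Division by zero gives u_k = 0 when s_k = 0, hence squared length r_k in {0, 1}
    and the family fits the Bessel-type lemmas.\<close>
  define u where "u k p = (Y * V) $$ (p, k) / of_real (s k)" for k p
  define r where "r k = (if s k = 0 then 0 else 1 :: real)" for k
  have u_orth: "(\<Sum>p<N. cnj (u k p) * u l p) = (if k = l then complex_of_real (r k) else 0)"
    if "k < N" "l < N" for k l
  proof -
    have "(\<Sum>p<N. cnj (u k p) * u l p) =
        (\<Sum>p<N. cnj ((Y * V) $$ (p, k)) * (Y * V) $$ (p, l)) / (of_real (s k) * of_real (s l))"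
      unfolding u_def sum_divide_distrib by (intro sum.cong refl) simp
    then show ?thesis unfolding orth[OF that] r_def by (simp add: power2_eq_square)
  qed
  have u_norm: "(\<Sum>p<N. (cmod (u k p))\<^sup>2) \<le> 1" if "k < N" for k
  proof -
    have "complex_of_real (\<Sum>p<N. (cmod (u k p))\<^sup>2) = complex_of_real (r k)"
      unfolding of_real_sum cmod_square_eq using u_orth[OF that that] by simp
    then have "(\<Sum>p<N. (cmod (u k p))\<^sup>2) = r k" unfolding of_real_eq_iff .
    then show ?thesis unfolding r_def by simp
  qed
  define t where "t k i = (\<Sum>p<N. cnj (u k p) * (T (E i) * V) $$ (p, k))" for k i
  have t_sum: "(\<Sum>i<N. a i * t k i) = (\<Sum>p<N. cnj (u k p) * (T (D a) * V) $$ (p, k))" if k: "k < N" for a k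
  proof -
    have "(T (D a) * V) $$ (p, k) = (\<Sum>i<N. a i * (T (E i) * V) $$ (p, k))" if p: "p < N" for p
    proof -
      have "(T (D a) * V) $$ (p, k) = (\<Sum>q<N. T (D a) $$ (p, q) * V $$ (q, k))"
        by (rule index_mult_mat_sum[OF TD Vc p k])
      also have "\<dots> = (\<Sum>q<N. \<Sum>i<N. a i * (T (E i) $$ (p, q) * V $$ (q, k)))"
        unfolding TD_sum using p by (intro sum.cong refl) (simp add: sum_distrib_right mult.assoc)
      also have "\<dots> = (\<Sum>i<N. \<Sum>q<N. a i * (T (E i) $$ (p, q) * V $$ (q, k)))" by (rule sum.swap)
      also have "\<dots> = (\<Sum>i<N. a i * (T (E i) * V) $$ (p, k))"
        unfolding index_mult_mat_sum[OF TE Vc p k] sum_distrib_left ..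
      finally show ?thesis .
    qed
    then have "(\<Sum>p<N. cnj (u k p) * (T (D a) * V) $$ (p, k)) =
        (\<Sum>p<N. \<Sum>i<N. a i * (cnj (u k p) * (T (E i) * V) $$ (p, k)))"
      by (intro sum.cong refl) (simp add: sum_distrib_left mult.left_commute)
    also have "\<dots> = (\<Sum>i<N. \<Sum>p<N. a i * (cnj (u k p) * (T (E i) * V) $$ (p, k)))" by (rule sum.swap)
    also have "\<dots> = (\<Sum>i<N. a i * t k i)" unfolding t_def sum_distrib_left ..
    finally show ?thesis by simp
  qed
  define b where "b a k = sqrt (\<Sum>p<N. (cmod ((T (D a) * V) $$ (p, k)))\<^sup>2)" for a k
  have t_sum_le: "cmod (\<Sum>i<N. a i * t k i) \<le> b a k" if "k < N" for a k
  proof -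
    have "cmod (\<Sum>i<N. a i * t k i) \<le> sqrt (\<Sum>p<N. (cmod (u k p))\<^sup>2) * b a k"
      unfolding t_sum[OF that] b_def by (rule cmod_inner_le)
    also have "\<dots> \<le> 1 * b a k"
      using u_norm[OF that] by (intro mult_right_mono) (auto simp: b_def sum_nonneg)
    finally show ?thesis by simp
  qed
  \<comment> \<open>The coefficients a_i = \<open>cnj (sgn (t k i))\<close> align the phases. As
    |a_i| <= 1, the matrix D a has operator norm at most 1, and the row sum becomes <u_k, T(D a)
    v_k>.\<close>
  have row: "(\<Sum>i<N. cmod (t k i)) \<le> \<beta>" if k: "k < N" for k
  proof -
    define a where "a i = cnj (sgn (t k i))" for i
    have "a i * t k i = complex_of_real (cmod (t k i))" for i
    proof (cases "t k i = 0")
      case False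
      have "cnj (t k i) * t k i = complex_of_real (cmod (t k i)) * complex_of_real (cmod (t k i))"
        using cmod_square_eq[of "t k i"] by (simp add: power2_eq_square)
      then show ?thesis using False unfolding a_def sgn_div_norm by (simp add: scaleR_conv_of_real field_simps)
    qed simp
    then have "(\<Sum>i<N. a i * t k i) = complex_of_real (\<Sum>i<N. cmod (t k i))" by simp
    then have "(\<Sum>i<N. cmod (t k i)) = cmod (\<Sum>i<N. a i * t k i)"
      by (metis abs_of_nonneg norm_ge_zero norm_of_real sum_nonneg)
    also have "\<dots> \<le> b a k" by (rule t_sum_le[OF k])
    also have "\<dots> \<le> sqrt ((schatten_inf_norm (T (D a)))\<^sup>2)"
      unfolding b_def by (intro real_sqrt_le_mono column_norm_le_schatten_inf TD V k)
    also have "\<dots> = schatten_inf_norm (T (D a))"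
      using schatten_norm_comparison(1)[OF TD] by simp
    also have "\<dots> \<le> \<beta> * schatten_inf_norm (D a)" by (rule \<beta>(2)[OF D])
    also have "\<dots> \<le> \<beta> * 1"
      unfolding D_def by (intro mult_left_mono schatten_inf_diagonal_in_le W)
        (use \<beta>(1) in \<open>auto simp: a_def norm_sgn\<close>)
    finally show ?thesis by simp
  qed
  \<comment> \<open>Trace duality against T(E_i), where E_i has trace norm 1.\<close>
  have col: "(\<Sum>k<N. cmod (t k i)) \<le> \<alpha>" if i: "i < N" for i
  proof -
    have "(\<Sum>k<N. cmod (t k i)) \<le> schatten_norm 1 (T (E i))"
      unfolding t_def by (rule sum_inner_le_schatten_1[OF TE V u_orth]) (auto simp: r_def)
    also have "\<dots> \<le> \<alpha> * schatten_norm 1 (E i)" by (rule \<alpha>(2)[OF E])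
    also have "schatten_norm 1 (E i) = (\<Sum>j<N. if j = i then 1 else 0)"
      unfolding E_def D_def schatten_1_diagonal_in[OF W] by (intro sum.cong refl) simp
    finally show ?thesis using i by simp
  qed

  define p where "p a = frobenius_norm N (T (D (\<lambda>i. complex_of_real (a i))))" for a
  \<comment> \<open>The s_k have square sum \<eta>^2; rescaling by \<eta> meets the normalisation of
    \<open>bilinear_form_bound\<close>.\<close>
  define \<sigma> where "\<sigma> k = s k / \<eta>" for k
  \<comment> \<open>Cauchy-Schwarz over k in J; the columns of T(D a) V have square sum ||T(D a)||^2
    because V is unitary.\<close>
  have dual: "cmod (\<Sum>k\<in>J. \<Sum>i<N. of_real (\<sigma> k * a i) * t k i) \<le> sqrt (\<Sum>k\<in>J. (\<sigma> k)\<^sup>2) * p a"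
    if J: "J \<subseteq> {..<N}" for J a
  proof -
    let ?a = "\<lambda>i. complex_of_real (a i)"
    have "cmod (\<Sum>k\<in>J. \<Sum>i<N. of_real (\<sigma> k * a i) * t k i) = cmod (\<Sum>k\<in>J. of_real (\<sigma> k) * (\<Sum>i<N. ?a i * t k i))"
      by (simp add: sum_distrib_left mult.assoc)
    also have "\<dots> \<le> (\<Sum>k\<in>J. \<bar>\<sigma> k\<bar> * \<bar>b ?a k\<bar>)"
    proof (rule sum_norm_le)
      fix k assume "k \<in> J"
      then have "k < N" using J by auto
      from t_sum_le[OF this, of ?a]
      show "cmod (of_real (\<sigma> k) * (\<Sum>i<N. ?a i * t k i)) \<le> \<bar>\<sigma> k\<bar> * \<bar>b ?a k\<bar>"
        unfolding norm_mult norm_of_real by (intro mult_left_mono) auto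
    qed
    also have "\<dots> \<le> L2_set \<sigma> J * L2_set (b ?a) J" by (rule L2_set_mult_ineq)
    also have "\<dots> \<le> sqrt (\<Sum>k\<in>J. (\<sigma> k)\<^sup>2) * p a"
      unfolding L2_set_def
    proof (rule mult_left_mono)
      have "(\<Sum>k\<in>J. (b ?a k)\<^sup>2) \<le> (\<Sum>k<N. (b ?a k)\<^sup>2)" by (rule sum_mono2) (use J in auto)
      also have "\<dots> = (\<Sum>k<N. \<Sum>q<N. (cmod ((T (D ?a) * V) $$ (q, k)))\<^sup>2)"
        unfolding b_def by (simp add: sum_nonneg)
      also have "\<dots> = (\<Sum>q<N. \<Sum>k<N. (cmod ((T (D ?a) * V) $$ (q, k)))\<^sup>2)" by (rule sum.swap)
      also have "\<dots> = (p a)\<^sup>2"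
        using frobenius_norm_mult_unitary[OF TD V] unfolding p_def frobenius_norm_square[symmetric] by simp
      finally show "sqrt (\<Sum>k\<in>J. (b ?a k)\<^sup>2) \<le> p a"
        by (rule real_le_lsqrt[rotated -1]) (simp add: p_def)
    qed (simp add: sum_nonneg)
    finally show ?thesis .
  qed
  have \<sigma>1: "(\<Sum>k<N. (\<sigma> k)\<^sup>2) = 1"
    using ss \<eta>(2) unfolding \<sigma>_def by (simp add: power_divide sum_divide_distrib[symmetric])
  \<comment> \<open>Summing over i first gives <u_k, Y v_k> = s_k by linearity, so the form is the
    sum of s_k^2 / \<eta>.\<close>
  have "(\<Sum>k<N. \<Sum>i<N. of_real (\<sigma> k * x i) * t k i) = complex_of_real \<eta>"
  proof -
    have "(\<Sum>i<N. of_real (\<sigma> k * x i) * t k i) = complex_of_real ((s k)\<^sup>2 / \<eta>)" if k: "k < N" for k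
    proof -
      have "(\<Sum>i<N. of_real (\<sigma> k * x i) * t k i) = of_real (\<sigma> k) * (\<Sum>i<N. complex_of_real (x i) * t k i)"
        by (simp add: sum_distrib_left mult.assoc)
      also have "(\<Sum>i<N. complex_of_real (x i) * t k i) = (\<Sum>p<N. cnj (u k p) * (Y * V) $$ (p, k))"
        unfolding t_sum[OF k] Y_def ..
      also have "\<dots> = (\<Sum>p<N. cnj ((Y * V) $$ (p, k)) * (Y * V) $$ (p, k)) / of_real (s k)"
        unfolding u_def sum_divide_distrib by (intro sum.cong refl) simp
      also have "of_real (\<sigma> k) * \<dots> = complex_of_real ((s k)\<^sup>2 / \<eta>)"
        unfolding orth[OF k k] \<sigma>_def by (simp add: power2_eq_square)
      finally show ?thesis .
    qed
    then have "(\<Sum>k<N. \<Sum>i<N. of_real (\<sigma> k * x i) * t k i) = complex_of_real (\<Sum>k<N. (s k)\<^sup>2 / \<eta>)" by simp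
    also have "(\<Sum>k<N. (s k)\<^sup>2 / \<eta>) = \<eta>"
      unfolding sum_divide_distrib[symmetric] ss using \<eta>(2) by (simp add: power2_eq_square)
    finally show ?thesis .
  qed
  then have form: "\<eta> = cmod (\<Sum>k<N. \<Sum>i<N. of_real (\<sigma> k * x i) * t k i)" using \<eta>(2) by simp

  interpret restricted_seminorm N p K
  proof
    fix a b :: "nat \<Rightarrow> real"
    have "D (\<lambda>i. complex_of_real (a i + b i)) = D (\<lambda>i. complex_of_real (a i)) + D (\<lambda>i. complex_of_real (b i))"
      unfolding D_def diagonal_in_add[OF Wc] by simp
    then show "p (\<lambda>i. a i + b i) \<le> p a + p b"
      unfolding p_def using frobenius_norm_triangle[OF TD TD] linear_add[OF lin D D] by simp
  next
    fix c :: real and a :: "nat \<Rightarrow> real" assume c: "c \<ge> 0"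
    have "D (\<lambda>i. complex_of_real (c * a i)) = complex_of_real c \<cdot>\<^sub>m D (\<lambda>i. complex_of_real (a i))"
      unfolding D_def diagonal_in_smult[OF Wc] by simp
    then show "p (\<lambda>i. c * a i) \<le> c * p a"
      unfolding p_def using frobenius_norm_smult[OF TD] linear_smult[OF lin D] c by simp
  next
    fix I assume I: "I \<subseteq> {..<N}"
    have "(\<lambda>i. complex_of_real (if i \<in> I then 1 else 0)) = (\<lambda>i. if i \<in> I then 1 else 0)" by auto
    then show "p (\<lambda>i. if i \<in> I then 1 else 0) \<le> K * sqrt (card I)"
      unfolding p_def D_def using K(2)[OF I] by simp
  qed (rule K(1))
  have \<sigma>0: "\<sigma> k \<ge> 0" for k unfolding \<sigma>_def using s0 \<eta>(2) by simp
  show "\<eta>\<^sup>2 \<le> \<alpha> * \<beta>" "\<eta> \<le> 3 * K * sqrt (1 + ln (16 * \<alpha> * \<beta> / \<eta>\<^sup>2))"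
    by (rule bilinear_form_bound[OF row col \<sigma>1 x1 \<alpha>(1) \<beta>(1) \<sigma>0 x0 dual form \<eta>(2)]; assumption)+
qed

section \<open>Deduction of the explicit constants by contradiction\<close>

theorem theorem4p1:
  fixes N :: nat and T :: "complex mat \<Rightarrow> complex mat"
  assumes "N \<ge> 1"
    and "linear_on_mats N T"
    and "\<exists>X \<in> carrier_mat N N. T X \<noteq> 0\<^sub>m N N"
  shows "\<exists>P. orth_projection N P \<and> P \<noteq> 0\<^sub>m N N \<and>
    induced_norm N (schatten_norm 2) T / (8 * sqrt (4 * ln (48 * (height N T)\<^sup>2) + 2))
      < schatten_norm 2 (T P) / schatten_norm 2 P \<and>
    schatten_norm 2 (T P) / schatten_norm 2 P \<le> induced_norm N (schatten_norm 2) T"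
proof (rule ccontr)
  define \<tau> where "\<tau> = induced_norm N (schatten_norm 2) T"
  define \<alpha> where "\<alpha> = induced_norm N (schatten_norm 1) T"
  define \<beta> where "\<beta> = induced_norm N schatten_inf_norm T"
  define z where "z = ln (48 * (height N T)\<^sup>2)"
  define K where "K = \<tau> / (8 * sqrt (4 * z + 2))"
  note lin = assms(2)
  note pos = frobenius_pos[OF lin] and TC = linear_carrier[OF lin]
  assume contr: "\<not> ?thesis"

  obtain X0 where X0: "X0 \<in> carrier_mat N N" "T X0 \<noteq> 0\<^sub>m N N" using assms(3) by blast
  have X0n: "X0 \<noteq> 0\<^sub>m N N" using X0 linear_zero[OF lin] by auto
  have two: "frobenius_norm N (T X) \<le> \<tau> * frobenius_norm N X" if "X \<in> carrier_mat N N" "X \<noteq> 0\<^sub>m N N" for X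
    unfolding \<tau>_def by (rule induced_2_bound[OF lin that])
  have "0 < frobenius_norm N (T X0)" by (rule pos[OF TC[OF X0(1)] X0(2)])
  then have "\<tau> * frobenius_norm N X0 > 0" using two[OF X0(1) X0n] by linarith
  then have \<tau>: "\<tau> > 0" using frobenius_norm_nonneg[of N X0] by (simp add: zero_less_mult_iff)
  have zero_norm: "schatten_norm 1 (0\<^sub>m N N) = 0" "schatten_inf_norm (0\<^sub>m N N) = 0"
  proof -
    have f0: "frobenius_norm N (0\<^sub>m N N) = 0" by (simp add: frobenius_norm_eq_0_iff)
    show "schatten_inf_norm (0\<^sub>m N N) = 0"
      using f0 schatten_norm_comparison(1,2)[OF zero_carrier_mat[of N N]] by simp
    then show "schatten_norm 1 (0\<^sub>m N N) = 0"
      using schatten_norm_comparison(3,4)[OF zero_carrier_mat[of N N]] f0 by simp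
  qed
  have \<alpha>b: "schatten_norm 1 (T X) \<le> \<alpha> * schatten_norm 1 X" if "X \<in> carrier_mat N N" for X
    using induced_1_bound[OF lin that] linear_zero[OF lin] zero_norm unfolding \<alpha>_def
    by (cases "X = 0\<^sub>m N N") auto
  have \<beta>b: "schatten_inf_norm (T X) \<le> \<beta> * schatten_inf_norm X" if "X \<in> carrier_mat N N" for X
    using induced_inf_bound[OF lin that] linear_zero[OF lin] zero_norm unfolding \<beta>_def
    by (cases "X = 0\<^sub>m N N") auto
  note cmp = schatten_norm_comparison[OF TC[OF X0(1)]] and cmp0 = schatten_norm_comparison[OF X0(1)]
  have "0 < schatten_norm 1 (T X0)" using cmp(3) \<open>0 < frobenius_norm N (T X0)\<close> by linarith
  then have "\<alpha> * schatten_norm 1 X0 > 0" using \<alpha>b[OF X0(1)] by linarith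
  moreover have "schatten_norm 1 X0 \<ge> 0" using cmp0 by linarith
  ultimately have \<alpha>: "\<alpha> > 0" by (simp add: zero_less_mult_iff)
  have "schatten_inf_norm (T X0) \<noteq> 0" using cmp \<open>0 < schatten_norm 1 (T X0)\<close> by auto
  then have "\<beta> * schatten_inf_norm X0 > 0" using cmp(1) \<beta>b[OF X0(1)] by linarith
  then have \<beta>: "\<beta> > 0" using cmp0(1) by (simp add: zero_less_mult_iff)
  have h: "(height N T)\<^sup>2 = \<alpha> * \<beta> / \<tau>\<^sup>2"
    unfolding height_def \<alpha>_def[symmetric] \<beta>_def[symmetric] \<tau>_def[symmetric]
    using \<alpha> \<beta> by (simp add: power_divide)

  \<comment> \<open>The upper half of the claim holds for every non-zero projection, so the negated
    goal says that the lower half fails for all of them.\<close>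
  have proj: "frobenius_norm N (T P) \<le> K * frobenius_norm N P"
    if P: "orth_projection N P" "P \<noteq> 0\<^sub>m N N" for P
  proof -
    have Pc: "P \<in> carrier_mat N N" using P(1) unfolding orth_projection_def by blast
    have "schatten_norm 2 (T P) / schatten_norm 2 P \<le> \<tau>"
      unfolding schatten_2_eq_frobenius[OF Pc] schatten_2_eq_frobenius[OF TC[OF Pc]]
      using two[OF Pc P(2)] pos[OF Pc P(2)] by (simp add: pos_divide_le_eq)
    then have "\<not> K < schatten_norm 2 (T P) / schatten_norm 2 P"
      using contr P unfolding K_def z_def \<tau>_def by blast
    then show ?thesis
      unfolding schatten_2_eq_frobenius[OF Pc] schatten_2_eq_frobenius[OF TC[OF Pc]]
      using pos[OF Pc P(2)] by (simp add: not_less pos_divide_le_eq)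
  qed

  \<comment> \<open>The factor sqrt (2/3) < 1 keeps 2 y strictly below \<tau>, so no maximiser of
    the supremum is required; its square yields the 6 in \<tau>^2 / 6, from which the constant 48
    arises.\<close>
  define y where "y = sqrt (2 / 3) * \<tau> / 2"
  have y: "y > 0" "y\<^sup>2 = \<tau>\<^sup>2 / 6" unfolding y_def using \<tau> by (auto simp: power_mult_distrib power_divide)
  have "\<exists>W a. unitary_mat N W \<and> (\<forall>i. a i \<ge> 0) \<and>
      y * frobenius_norm N (diagonal_in N W (\<lambda>i. complex_of_real (a i)))
        < frobenius_norm N (T (diagonal_in N W (\<lambda>i. complex_of_real (a i))))"
  proof (rule ccontr)
    assume no: "\<not> ?thesis"
    have small: "frobenius_norm N (T (diagonal_in N W (\<lambda>i. complex_of_real (a i))))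
        \<le> y * frobenius_norm N (diagonal_in N W (\<lambda>i. complex_of_real (a i)))"
      if "unitary_mat N W" "\<And>i. a i \<ge> 0" for W a
      using no that by (meson not_less)
    have le: "frobenius_norm N (T X) \<le> 2 * y * frobenius_norm N X" if "X \<in> carrier_mat N N" for X
      by (rule bound_from_positive[OF lin small less_imp_le[OF y(1)] that])
    have "\<tau> \<le> 2 * y"
      unfolding \<tau>_def induced_norm_def
    proof (rule cSup_least)
      show "{schatten_norm 2 (T X) / schatten_norm 2 X |X. X \<in> carrier_mat N N \<and> X \<noteq> 0\<^sub>m N N} \<noteq> {}"
        using X0(1) X0n by blast
      fix q assume "q \<in> {schatten_norm 2 (T X) / schatten_norm 2 X |X. X \<in> carrier_mat N N \<and> X \<noteq> 0\<^sub>m N N}"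
      then obtain X where q: "q = schatten_norm 2 (T X) / schatten_norm 2 X" and X: "X \<in> carrier_mat N N" "X \<noteq> 0\<^sub>m N N"
        by blast
      show "q \<le> 2 * y"
        unfolding q schatten_2_eq_frobenius[OF X(1)] schatten_2_eq_frobenius[OF TC[OF X(1)]]
        using le[OF X(1)] pos[OF X] by (simp add: pos_divide_le_eq)
    qed
    moreover have "sqrt (2 / 3) < (1 :: real)" by simp
    ultimately show False unfolding y_def using \<tau> by simp
  qed
  then obtain W a where W: "unitary_mat N W" and a0: "\<And>i. a i \<ge> 0" and large:
    "y * frobenius_norm N (diagonal_in N W (\<lambda>i. complex_of_real (a i)))
      < frobenius_norm N (T (diagonal_in N W (\<lambda>i. complex_of_real (a i))))"
    by blast
  note Wc = unitary_matD(1)[OF W]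
  define R where "R = frobenius_norm N (diagonal_in N W (\<lambda>i. complex_of_real (a i)))"
  have R: "R = sqrt (\<Sum>i<N. (a i)\<^sup>2)" unfolding R_def frobenius_norm_diagonal_in[OF W] by simp
  have "R \<noteq> 0"
  proof
    assume "R = 0"
    then have "diagonal_in N W (\<lambda>i. complex_of_real (a i)) = 0\<^sub>m N N"
      unfolding R_def using Wc by (simp add: frobenius_norm_eq_0_iff)
    then show False using large linear_zero[OF lin] frobenius_norm_eq_0_iff[of "0\<^sub>m N N" N] by simp
  qed
  then have Rpos: "R > 0" unfolding R_def using frobenius_norm_nonneg less_eq_real_def by metis
  define x where "x i = a i / R" for i
  have x0: "x i \<ge> 0" for i unfolding x_def using a0 Rpos by simp
  have x1: "(\<Sum>i<N. (x i)\<^sup>2) = 1"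
  proof -
    have "(\<Sum>i<N. (a i)\<^sup>2) = R\<^sup>2" unfolding R by (simp add: sum_nonneg)
    then have "(\<Sum>i<N. (x i)\<^sup>2) = R\<^sup>2 / R\<^sup>2"
      unfolding x_def power_divide sum_divide_distrib[symmetric] by (simp only:)
    then show ?thesis using Rpos by simp
  qed
  define \<eta> where "\<eta> = frobenius_norm N (T (diagonal_in N W (\<lambda>i. complex_of_real (x i))))"
  have "y < \<eta>"
  proof -
    have "diagonal_in N W (\<lambda>i. complex_of_real (x i)) = complex_of_real (1 / R) \<cdot>\<^sub>m diagonal_in N W (\<lambda>i. complex_of_real (a i))"
      unfolding x_def diagonal_in_smult[OF Wc] by simp
    then have "\<eta> = 1 / R * frobenius_norm N (T (diagonal_in N W (\<lambda>i. complex_of_real (a i))))"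
      unfolding \<eta>_def using linear_smult[OF lin diagonal_in_carrier[OF Wc]]
        frobenius_norm_smult[OF TC[OF diagonal_in_carrier[OF Wc]]] Rpos
      by (simp add: norm_divide)
    then show ?thesis using large Rpos unfolding R_def[symmetric] by (simp add: pos_less_divide_eq)
  qed
  then have \<eta>: "\<eta> > 0" "\<tau>\<^sup>2 / 6 < \<eta>\<^sup>2"
    using y by (auto simp flip: y(2) intro: power_strict_mono)

  have indicator: "frobenius_norm N (diagonal_in N W (\<lambda>i. if i \<in> I then 1 else 0)) = sqrt (card I)"
    if "I \<subseteq> {..<N}" for I
  proof -
    have "(\<Sum>i<N. (cmod (if i \<in> I then 1 else 0))\<^sup>2) = (\<Sum>i<N. if i \<in> I then 1 else 0)"
      by (intro sum.cong refl) simp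
    also have "\<dots> = real (card I)" using that by (simp add: sum.If_cases Int_absorb1)
    finally show ?thesis unfolding frobenius_norm_diagonal_in[OF W] by simp
  qed
  \<comment> \<open>Stated for any L since it is used twice: with \<tau> to get \<eta>^2 <= \<alpha>
    \<beta>, and with K once this has shown that K is positive.\<close>
  have step: "\<eta>\<^sup>2 \<le> \<alpha> * \<beta> \<and> \<eta> \<le> 3 * L * sqrt (1 + ln (16 * \<alpha> * \<beta> / \<eta>\<^sup>2))"
    if L: "L \<ge> 0" "\<And>P. orth_projection N P \<Longrightarrow> P \<noteq> 0\<^sub>m N N \<Longrightarrow> frobenius_norm N (T P) \<le> L * frobenius_norm N P" for L
  proof -
    have "frobenius_norm N (T (diagonal_in N W (\<lambda>i. if i \<in> I then 1 else 0))) \<le> L * sqrt (card I)"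
      if I: "I \<subseteq> {..<N}" for I
    proof (cases "diagonal_in N W (\<lambda>i. if i \<in> I then 1 else 0) = 0\<^sub>m N N")
      case True
      then show ?thesis using linear_zero[OF lin] frobenius_norm_eq_0_iff[of "0\<^sub>m N N" N] L(1) by simp
    next
      case False
      then show ?thesis using L(2)[OF orth_projection_diagonal_in[OF W] False] indicator[OF I] by simp
    qed
    from positive_matrix_estimate[OF lin W x0 x1 L(1) this \<alpha> \<alpha>b \<beta> \<beta>b \<eta>_def \<eta>(1)] show ?thesis by blast
  qed
  have ab: "\<eta>\<^sup>2 \<le> \<alpha> * \<beta>"
    using step[of \<tau>] \<tau> two unfolding orth_projection_def by auto
  \<comment> \<open>This bounds the height below: 6 h(T)^2 > 1 makes 48 h(T)^2 > 8, so z > 0 and the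
    root in K is that of a positive number.\<close>
  have "\<tau>\<^sup>2 < 6 * (\<alpha> * \<beta>)" using ab \<eta>(2) by linarith
  then have h6: "1 < 6 * (height N T)\<^sup>2" unfolding h using \<tau> by (simp add: field_simps)
  then have z: "z > 0" unfolding z_def by (intro ln_gt_zero) linarith
  have K: "K > 0" unfolding K_def using z \<tau> by simp
  \<comment> \<open>Here 16 * 6 = 2 * 48; the surplus factor 2 adds ln 2 < 1 to the logarithm and
    leads to 2 + z under the root.\<close>
  have "16 * \<alpha> * \<beta> / \<eta>\<^sup>2 \<le> 16 * \<alpha> * \<beta> / (\<tau>\<^sup>2 / 6)"
    by (rule divide_left_mono) (use \<eta> \<alpha> \<beta> \<tau> in auto)
  also have "\<dots> = 2 * (48 * (height N T)\<^sup>2)" unfolding h by simp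
  finally have Q: "16 * \<alpha> * \<beta> / \<eta>\<^sup>2 \<le> 2 * (48 * (height N T)\<^sup>2)" .
  have "ln (16 * \<alpha> * \<beta> / \<eta>\<^sup>2) \<le> ln (2 * (48 * (height N T)\<^sup>2))"
    by (rule ln_mono[OF Q]) (use \<eta> \<alpha> \<beta> in auto)
  also have "\<dots> = ln 2 + z" unfolding z_def using h6 by (subst ln_mult) auto
  finally have "ln (16 * \<alpha> * \<beta> / \<eta>\<^sup>2) \<le> 1 + z" using ln_2_less_1 by linarith
  then have "sqrt (1 + ln (16 * \<alpha> * \<beta> / \<eta>\<^sup>2)) \<le> sqrt (2 + z)" by simp
  then have "3 * K * sqrt (1 + ln (16 * \<alpha> * \<beta> / \<eta>\<^sup>2)) \<le> 3 * K * sqrt (2 + z)"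
    by (rule mult_left_mono) (use K in simp)
  moreover have "\<eta> \<le> 3 * K * sqrt (1 + ln (16 * \<alpha> * \<beta> / \<eta>\<^sup>2))"
    using step[OF less_imp_le[OF K] proj] by blast
  ultimately have "\<eta> \<le> 3 * K * sqrt (2 + z)" by linarith
  then have "\<eta>\<^sup>2 \<le> (3 * K * sqrt (2 + z))\<^sup>2" using \<eta>(1) by (intro power_mono) auto
  also have "\<dots> = 9 * (2 + z) * \<tau>\<^sup>2 / (64 * (4 * z + 2))"
    unfolding K_def using z by (simp add: power_mult_distrib power_divide)
  finally have "\<tau>\<^sup>2 / 6 < 9 * (2 + z) * \<tau>\<^sup>2 / (64 * (4 * z + 2))" using \<eta>(2) by linarith
  \<comment> \<open>After cancelling \<tau>^2 this reads 256 z + 128 < 54 z + 108, impossible for z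
    > 0.\<close>
  then have "\<tau>\<^sup>2 * (64 * (4 * z + 2)) < \<tau>\<^sup>2 * (54 * (2 + z))" using z by (simp add: field_simps)
  then have "64 * (4 * z + 2) < 54 * (2 + z)" using \<tau> by (simp add: mult_less_cancel_left_pos)
  then show False using z by simp
qed

end
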